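(* There exist universal constants $C_0, C_1, C_2, C_3, C_4, C_5, c, c' > 0$ such that the following holds for all integers $d \geq 1$, $M \geq 2$ with $\frac{M}{\log(M)} \geq C_0\, d\log(d)$. Fix $x \in S^{d-1}$ and draw i.i.d. random vectors $g^{(1)},\dots,g^{(M)} \sim \mathcal{N}(0, d^{-1} I_d)$ in $\mathbb{R}^d$. Let $V \subset [M]$ be a set of $\lceil C_1 d \log(d)\rceil$ distinct indices, selected once and for all from $[M]$ without replacement, independently of $x$ and of the vectors $g^{(i)}$. Set $$\tau = C_2 \frac{\sqrt{d}\,\log(d)\log(M)}{M},$$ $$W_{\tau,x} := \{ i \in [M] : -\tau < \langle g^{(i)}, x\rangle < 0\}, \qquad S_{\tau,x} := W_{\tau,x} \cup V .$$ Then, with probability at least $1 - 3\exp(-c\, d\log(d)) - \exp(-c'\, d\log(M))$, both of the following hold: (1) $C_3\, d\log(d)\log(M) \leq |S_{\tau,x}| \leq C_4\, d\log(d)\log(M)$; (2) for every $y \in S^{d-1}$ such that $\operatorname{sign}(\langle g^{(i)}, x\rangle) = \operatorname{sign}(\langle g^{(i)}, y\rangle)$ for all $i \in S_{\tau,x}$, $$\|x - y\|_2 \leq \frac{C_5\, d\log(d)\log(M)}{\sqrt{M^2 + d^2 \log^2(d)\log^2(M)}} .$$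
   Context: $\langle\cdot,\cdot\rangle$ is the standard inner product on $\mathbb{R}^d$, $\|\cdot\|_2$ is the Euclidean norm, $S^{d-1}$ is the Euclidean unit sphere of $\mathbb{R}^d$, $I_d$ is the $d\times d$ identity matrix, and $[M] = \{1,\dots,M\}$. A universal constant is a number not depending on $d$, $M$, $x$, or any other parameter. *)

theory Defs
  imports "HOL-Probability.Probability"
begin

text \<open>The dimension \<open>d\<close> is quantified below the universal constants, so it cannot be a type.
  A point of \<open>\<real>\<^sup>d\<close> is a function in \<^term>\<open>{..<d} \<rightarrow>\<^sub>E (UNIV :: real set)\<close>, i.e. an element of the
  space of a \<^term>\<open>PiM {..<d}\<close> measure; \<^const>\<open>L2_set\<close> over \<^term>\<open>{..<d}\<close> is its Euclidean norm.\<close>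

definition inner_prod :: "nat \<Rightarrow> (nat \<Rightarrow> real) \<Rightarrow> (nat \<Rightarrow> real) \<Rightarrow> real" where
  "inner_prod d u v = (\<Sum>k<d. u k * v k)"

definition norm2 :: "nat \<Rightarrow> (nat \<Rightarrow> real) \<Rightarrow> real" where
  "norm2 d u = L2_set u {..<d}"

definition unit_sphere :: "nat \<Rightarrow> (nat \<Rightarrow> real) set" where
  "unit_sphere d = {u \<in> {..<d} \<rightarrow>\<^sub>E UNIV. norm2 d u = 1}"

text \<open>\<open>N(0, d\<^sup>-\<^sup>1 I\<^sub>d)\<close>: the covariance is diagonal, so the coordinates are independent
  \<open>N(0, 1/d)\<close>. The second argument of \<^const>\<open>normal_density\<close> is the standard deviation.\<close>

definition gaussian_vector :: "nat \<Rightarrow> (nat \<Rightarrow> real) measure" where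
  "gaussian_vector d =
     (\<Pi>\<^sub>M k\<in>{..<d}. density lborel (\<lambda>t. ennreal (normal_density 0 (1 / sqrt (real d)) t)))"

definition gaussian_sample :: "nat \<Rightarrow> nat \<Rightarrow> (nat \<Rightarrow> nat \<Rightarrow> real) measure" where
  "gaussian_sample d M = (\<Pi>\<^sub>M i\<in>{1..M}. gaussian_vector d)"

text \<open>A law for selecting \<open>n\<close> distinct indices from \<open>[M]\<close>: any probability measure on the
  \<open>n\<close>-element subsets. Point masses (a fixed set) and the uniform law (sampling without
  replacement) are instances.\<close>

definition selection_law :: "nat \<Rightarrow> nat \<Rightarrow> nat set measure \<Rightarrow> bool" where
  "selection_law M n Q \<longleftrightarrow> prob_space Q \<and> sets Q = Pow {V. V \<subseteq> {1..M} \<and> card V = n}"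

definition window :: "nat \<Rightarrow> nat \<Rightarrow> real \<Rightarrow> (nat \<Rightarrow> real) \<Rightarrow> (nat \<Rightarrow> nat \<Rightarrow> real) \<Rightarrow> nat set" where
  "window d M \<tau> x g = {i \<in> {1..M}. - \<tau> < inner_prod d (g i) x \<and> inner_prod d (g i) x < 0}"

end

theory Submission
  imports Defs
begin

text \<open>
  The hyperplanes that narrowly miss \<open>x\<close>, those in the window, force a consistent \<open>y\<close> to be close
  to \<open>x\<close>; the set \<open>V\<close> adds a term of lower order to the cardinality. Write
  \<open>B = d log d log M\<close> and \<open>h = sqrt d * \<tau> = C\<^sub>2 B / M\<close>. If
  \<open>y = t x + s u\<close> with a unit vector \<open>u\<close> orthogonal to \<open>x\<close>, then an index \<open>i\<close> in the window with
  \<open>\<langle>g\<^sub>i, u\<rangle> \<ge> 1 / sqrt d\<close> separates \<open>x\<close> from \<open>y\<close> unless \<open>t > 0\<close> and \<open>s < h\<close>, in which case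
  \<open>\<parallel>x - y\<parallel> \<le> sqrt 2 * h\<close> (\<open>consistent_close\<close>). It remains to find such an index for all directions
  \<open>u\<close> simultaneously.

  For fixed \<open>u\<close> the variables \<open>\<langle>g, x\<rangle>\<close> and \<open>\<langle>g, u\<rangle>\<close> are independent normal variables, so a single
  vector is in the window and far along \<open>u\<close> with probability at least a constant times \<open>h\<close>
  (\<open>gaussian_slab_cap_prob\<close>). All \<open>M\<close> vectors fail with probability at most
  \<open>exp (- const * h * M) = exp (- const * C\<^sub>2 * B)\<close>. On the event that all coordinates of all vectors
  are \<open>O(log M)\<close>, which fails with probability at most \<open>exp (- d log M)\<close>, a grid of width of order
  \<open>1 / (d\<^sup>2 log M)\<close> suffices for the passage to all directions, and it has at most \<open>exp (10 B)\<close> cells,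
  so a large \<open>C\<^sub>2\<close> wins (\<open>gaussian_sample_good_event\<close>, \<open>failure_bound\<close>). The window count is binomial
  with mean of order \<open>B\<close>, and Chernoff bounds (\<open>power_count_tails\<close>) give the cardinality claim.

  Two points need separate arguments. Independence of the two projections is deduced from
  one-dimensional characteristic functions (\<open>indep_of_char_factorization\<close>). And the event
  quantifies over the uncountably many \<open>y\<close> on the sphere, so its measurability is not automatic; it
  follows from compactness of the sphere (\<open>measurable_exists_consistent\<close>). All bounds hold for each
  fixed \<open>V\<close>, hence also for a random selection (\<open>pair_prob_ge\<close>).
\<close>

section \<open>Independence from characteristic functions\<close>

text \<open>A nonnegative weight \<open>w\<close> that only rescales the characteristic function of \<open>U\<close> does not
  change the law of \<open>U\<close>: after normalising \<open>w\<close> to a probability density, Levy's uniqueness theorem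
  applies. If \<open>w\<close> has mean zero it cannot be normalised, but then it vanishes almost everywhere.\<close>

lemma (in prob_space) weighted_law_eqI:
  fixes U w :: "'a \<Rightarrow> real"
  assumes U [measurable]: "U \<in> borel_measurable M" and w: "integrable M w"
    and nonneg: "\<And>\<omega>. 0 \<le> w \<omega>"
    and char: "\<And>t. (CLINT \<omega>|M. w \<omega> *\<^sub>R iexp (t * U \<omega>)) =
                   expectation w *\<^sub>R (CLINT \<omega>|M. iexp (t * U \<omega>))"
    and B [measurable]: "B \<in> sets borel"
  shows "expectation (\<lambda>\<omega>. w \<omega> * indicator B (U \<omega>)) = expectation w * prob (U -` B \<inter> space M)"
proof (cases "expectation w = 0")
  case True
  then have "AE \<omega> in M. w \<omega> = 0"
    using integral_nonneg_eq_0_iff_AE[OF w] nonneg by simp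
  then have "expectation (\<lambda>\<omega>. w \<omega> * indicator B (U \<omega>)) = expectation (\<lambda>\<omega>. 0)"
    using w by (intro integral_cong_AE) (auto intro!: borel_measurable_integrable)
  with True show ?thesis by simp
next
  case False
  define c where "c = expectation w"
  have c: "c > 0" using False nonneg unfolding c_def
    by (simp add: integral_nonneg less_le)
  have [measurable]: "w \<in> borel_measurable M" using w by simp
  define N where "N = density M (\<lambda>\<omega>. ennreal (w \<omega> / c))"
  have intw: "integrable M (\<lambda>\<omega>. w \<omega> / c)" using w by simp
  have "emeasure N (space N) = (\<integral>\<^sup>+\<omega>. ennreal (w \<omega> / c) \<partial>M)"
    unfolding N_def by (simp add: emeasure_density cong: nn_integral_cong)
  also have "\<dots> = ennreal (expectation (\<lambda>\<omega>. w \<omega> / c))"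
    using intw nonneg c by (intro nn_integral_eq_integral) auto
  also have "\<dots> = 1" using c by (simp add: c_def)
  finally interpret N: prob_space N by (rule prob_spaceI)
  have UN [measurable]: "U \<in> borel_measurable N" by (simp add: N_def)
  have "char (distr N borel U) = char (distr M borel U)"
  proof
    fix t
    have "char (distr N borel U) t = (CLINT \<omega>|N. iexp (t * U \<omega>))"
      by (simp add: char_def integral_distr)
    also have "\<dots> = (CLINT \<omega>|M. (w \<omega> / c) *\<^sub>R iexp (t * U \<omega>))"
      unfolding N_def using c nonneg by (intro integral_density) auto
    also have "\<dots> = (CLINT \<omega>|M. (1 / c) *\<^sub>R (w \<omega> *\<^sub>R iexp (t * U \<omega>)))"
      by (intro Bochner_Integration.integral_cong) auto
    also have "\<dots> = (1 / c) *\<^sub>R (c *\<^sub>R (CLINT \<omega>|M. iexp (t * U \<omega>)))"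
      by (simp only: integral_scaleR_right char c_def)
    also have "\<dots> = char (distr M borel U) t"
      using c by (simp add: char_def integral_distr)
    finally show "char (distr N borel U) t = char (distr M borel U) t" .
  qed
  then have eq: "distr N borel U = distr M borel U"
    by (intro Levy_uniqueness) auto
  have "prob (U -` B \<inter> space M) = measure (distr M borel U) B"
    by (simp add: measure_distr)
  also have "\<dots> = measure N (U -` B \<inter> space N)"
    by (simp add: eq[symmetric] measure_distr)
  also have "\<dots> = (LINT \<omega>|N. indicator (U -` B \<inter> space N) \<omega>)"
    by simp
  also have "\<dots> = (LINT \<omega>|M. (w \<omega> / c) *\<^sub>R indicator (U -` B \<inter> space M) \<omega>)"
    unfolding N_def using c nonneg by (subst integral_density) auto
  also have "\<dots> = (LINT \<omega>|M. w \<omega> * indicator B (U \<omega>) / c)"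
    by (intro Bochner_Integration.integral_cong) (auto simp: indicator_def)
  finally show ?thesis using c by (simp add: c_def)
qed

text \<open>Independence of two real variables from the factorisation of their joint characteristic
  function, by the one-dimensional uniqueness theorem alone. The weights \<open>1 + cos (s X + \<theta>)\<close> are
  nonnegative, and by the factorisation they only rescale the characteristic function of \<open>U\<close>; the
  preceding lemma therefore decouples \<open>cos (s X + \<theta>)\<close> from the event \<open>U \<in> B\<close>. The phases \<open>0\<close> and
  \<open>- \<pi> / 2\<close> recombine to \<open>exp (i s X)\<close>. So the weight \<open>1\<^sub>B(U)\<close> only rescales the
  characteristic function of \<open>X\<close>, and the same lemma with the roles exchanged decouples the two
  events.\<close>

theorem (in prob_space) indep_of_char_factorization:
  fixes X U :: "'a \<Rightarrow> real"
  assumes X [measurable]: "X \<in> borel_measurable M" and U [measurable]: "U \<in> borel_measurable M"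
    and fact: "\<And>s t. (CLINT \<omega>|M. iexp (s * X \<omega> + t * U \<omega>)) =
                   (CLINT \<omega>|M. iexp (s * X \<omega>)) * (CLINT \<omega>|M. iexp (t * U \<omega>))"
    and A [measurable]: "A \<in> sets borel" and B [measurable]: "B \<in> sets borel"
  shows "prob {\<omega> \<in> space M. X \<omega> \<in> A \<and> U \<omega> \<in> B} =
         prob {\<omega> \<in> space M. X \<omega> \<in> A} * prob {\<omega> \<in> space M. U \<omega> \<in> B}"
proof -
  note [simp del] = of_real_mult of_real_add
  have ii: "integrable M (\<lambda>\<omega>. iexp (f \<omega>))" if "f \<in> borel_measurable M" for f
    using that by (intro integrable_iexp) auto
  define q where "q = prob {\<omega> \<in> space M. U \<omega> \<in> B}"
  have q: "prob (U -` B \<inter> space M) = q"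
    unfolding q_def by (intro arg_cong[where f=prob]) auto
  define \<phi> where "\<phi> s = (CLINT \<omega>|M. iexp (s * X \<omega>))" for s
  define \<psi> where "\<psi> t = (CLINT \<omega>|M. iexp (t * U \<omega>))" for t
  have fact': "(CLINT \<omega>|M. iexp (s * X \<omega>) * iexp (t * U \<omega>)) = \<phi> s * \<psi> t" for s t
    using fact[of s t] by (simp add: \<phi>_def \<psi>_def of_real_add distrib_left exp_add)
  have iprod: "integrable M (\<lambda>\<omega>. iexp (s * X \<omega>) * iexp (t * U \<omega>))" for s t
    using ii[of "\<lambda>\<omega>. s * X \<omega> + t * U \<omega>"] by (simp add: of_real_add distrib_left exp_add)
  have cosE: "complex_of_real (cos r) = (iexp r + iexp (- r)) / 2" for r
    by (simp add: cos_of_real[symmetric] cos_exp_eq)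
  have sh: "iexp (r + \<theta>) = iexp \<theta> * iexp r" for r \<theta>
    by (simp add: of_real_add distrib_left exp_add)
  have shift: "complex_of_real (cos (r + \<theta>)) = (iexp \<theta> * iexp r + iexp (- \<theta>) * iexp (- r)) / 2" for r \<theta>
    using sh[of r \<theta>] sh[of "-r" "-\<theta>"] by (simp add: cosE)
  have icos: "integrable M (\<lambda>\<omega>. cos (s * X \<omega> + \<theta>))" for s \<theta>
    by (intro integrable_const_bound[of _ 1]) simp_all
  have icosB: "integrable M (\<lambda>\<omega>. cos (s * X \<omega> + \<theta>) * indicator B (U \<omega>))" for s \<theta>
    by (intro integrable_const_bound[of _ 1]) (auto simp: indicator_def)
  have iB: "integrable M (\<lambda>\<omega>. indicator B (U \<omega>) :: real)"
    by (intro integrable_const_bound[of _ 1]) (auto simp: indicator_def)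
  have EB: "expectation (\<lambda>\<omega>. indicator B (U \<omega>)) = q"
  proof -
    have "expectation (\<lambda>\<omega>. indicat_real B (U \<omega>)) = expectation (indicat_real (U -` B \<inter> space M))"
      by (intro Bochner_Integration.integral_cong) (auto simp: indicator_def)
    then show ?thesis by (simp add: q)
  qed
  have cosw: "expectation (\<lambda>\<omega>. cos (s * X \<omega> + \<theta>) * indicator B (U \<omega>)) =
      expectation (\<lambda>\<omega>. cos (s * X \<omega> + \<theta>)) * q" (is "?L = ?R") for s \<theta>
  proof -
    have e0: "complex_of_real (expectation (\<lambda>\<omega>. cos (s * X \<omega> + \<theta>))) =
        (iexp \<theta> * \<phi> s + iexp (- \<theta>) * \<phi> (- s)) / 2"
    proof -
      have "complex_of_real (expectation (\<lambda>\<omega>. cos (s * X \<omega> + \<theta>))) =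
          (CLINT \<omega>|M. (iexp \<theta> * iexp (s * X \<omega>) + iexp (- \<theta>) * iexp (- s * X \<omega>)) / 2)"
        by (simp add: integral_complex_of_real[symmetric] shift)
      also have "\<dots> = (iexp \<theta> * \<phi> s + iexp (- \<theta>) * \<phi> (- s)) / 2"
        unfolding \<phi>_def
        by (simp only: Bochner_Integration.integral_add integral_divide_zero integral_mult_right_zero
            ii integrable_divide integrable_mult_right Bochner_Integration.integrable_add
            X borel_measurable_times borel_measurable_const)
      finally show ?thesis .
    qed
    have e1: "(CLINT \<omega>|M. (1 + cos (s * X \<omega> + \<theta>)) *\<^sub>R iexp (t * U \<omega>)) =
           expectation (\<lambda>\<omega>. 1 + cos (s * X \<omega> + \<theta>)) *\<^sub>R (CLINT \<omega>|M. iexp (t * U \<omega>))" for t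
    proof -
      have "(CLINT \<omega>|M. (1 + cos (s * X \<omega> + \<theta>)) *\<^sub>R iexp (t * U \<omega>)) =
        (CLINT \<omega>|M. iexp (t * U \<omega>) + (iexp \<theta> * (iexp (s * X \<omega>) * iexp (t * U \<omega>))
           + iexp (-\<theta>) * (iexp (-s * X \<omega>) * iexp (t * U \<omega>))) / 2)"
        by (intro Bochner_Integration.integral_cong)
           (simp_all add: scaleR_conv_of_real of_real_add shift algebra_simps add_divide_distrib)
      also have "\<dots> = \<psi> t + (iexp \<theta> * (\<phi> s * \<psi> t) + iexp (-\<theta>) * (\<phi> (-s) * \<psi> t)) / 2"
        by (simp only: fact' \<psi>_def[symmetric] Bochner_Integration.integral_add integral_divide_zero integral_mult_right_zero
            ii iprod integrable_divide integrable_mult_right Bochner_Integration.integrable_add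
            U borel_measurable_times borel_measurable_const)
      also have "\<dots> = (1 + (iexp \<theta> * \<phi> s + iexp (- \<theta>) * \<phi> (- s)) / 2) * \<psi> t" by (simp add: field_simps)
      also have "\<dots> = of_real (expectation (\<lambda>\<omega>. 1 + cos (s * X \<omega> + \<theta>))) * \<psi> t"
        by (simp add: Bochner_Integration.integral_add icos prob_space of_real_add e0)
      finally show ?thesis by (simp add: \<psi>_def scaleR_conv_of_real)
    qed
    have "expectation (\<lambda>\<omega>. (1 + cos (s * X \<omega> + \<theta>)) * indicator B (U \<omega>)) =
          expectation (\<lambda>\<omega>. 1 + cos (s * X \<omega> + \<theta>)) * q"
      unfolding q[symmetric]
    proof (rule weighted_law_eqI[OF U _ _ e1])
      show "0 \<le> 1 + cos (s * X \<omega> + \<theta>)" for \<omega>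
        using cos_ge_minus_one[of "s * X \<omega> + \<theta>"] by linarith
    qed (simp_all add: icos)
    moreover have "expectation (\<lambda>\<omega>. (1 + cos (s * X \<omega> + \<theta>)) * indicator B (U \<omega>)) = q + ?L"
      by (simp add: distrib_right icosB iB EB)
    moreover have "expectation (\<lambda>\<omega>. 1 + cos (s * X \<omega> + \<theta>)) = 1 + expectation (\<lambda>\<omega>. cos (s * X \<omega> + \<theta>))"
      by (simp add: icos prob_space)
    ultimately show ?thesis by (simp add: algebra_simps)
  qed
  have sincos: "iexp r = of_real (cos (r + 0)) + \<i> * of_real (cos (r + - pi / 2))" for r
    by (simp add: exp_Euler cos_of_real sin_of_real cos_diff)
  have iexpB: "(CLINT \<omega>|M. indicator B (U \<omega>) *\<^sub>R iexp (s * X \<omega>)) =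
      expectation (\<lambda>\<omega>. indicator B (U \<omega>)) *\<^sub>R (CLINT \<omega>|M. iexp (s * X \<omega>))" for s
  proof -
    have "(CLINT \<omega>|M. indicator B (U \<omega>) *\<^sub>R iexp (s * X \<omega>)) =
       (CLINT \<omega>|M. of_real (cos (s * X \<omega> + 0) * indicator B (U \<omega>))
          + \<i> * of_real (cos (s * X \<omega> + - pi / 2) * indicator B (U \<omega>)))"
      by (subst sincos, intro Bochner_Integration.integral_cong)
         (simp_all add: indicator_def)
    also have "\<dots> = of_real (expectation (\<lambda>\<omega>. cos (s * X \<omega> + 0)) * q)
         + \<i> * of_real (expectation (\<lambda>\<omega>. cos (s * X \<omega> + - pi / 2)) * q)"
      unfolding cosw[symmetric]
      by (simp only: Bochner_Integration.integral_add integral_mult_right_zero integral_complex_of_real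
          integrable_of_real integrable_mult_right icosB)
    also have "\<dots> = of_real q * (CLINT \<omega>|M. of_real (cos (s * X \<omega> + 0))
          + \<i> * of_real (cos (s * X \<omega> + - pi / 2)))"
      by (simp only: Bochner_Integration.integral_add integral_mult_right_zero integral_complex_of_real
          integrable_of_real integrable_mult_right icos of_real_mult distrib_left mult_ac)
    also have "\<dots> = q *\<^sub>R (CLINT \<omega>|M. iexp (s * X \<omega>))"
      by (simp only: sincos[symmetric] scaleR_conv_of_real)
    finally show ?thesis by (simp add: EB)
  qed
  have "prob {\<omega> \<in> space M. X \<omega> \<in> A \<and> U \<omega> \<in> B} =
      expectation (indicator {\<omega> \<in> space M. X \<omega> \<in> A \<and> U \<omega> \<in> B})" by simp
  also have "\<dots> = expectation (\<lambda>\<omega>. indicator B (U \<omega>) * indicator A (X \<omega>))"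
    by (intro Bochner_Integration.integral_cong) (auto simp: indicator_def)
  also have "\<dots> = expectation (\<lambda>\<omega>. indicator B (U \<omega>)) * prob (X -` A \<inter> space M)"
    by (rule weighted_law_eqI[OF X iB _ iexpB A]) simp
  also have "X -` A \<inter> space M = {\<omega> \<in> space M. X \<omega> \<in> A}" by auto
  finally show ?thesis by (simp add: EB q_def)
qed

section \<open>Centred normal laws on the line\<close>

definition normal_law :: "real \<Rightarrow> real measure" where
  "normal_law \<sigma> = density lborel (\<lambda>t. ennreal (normal_density 0 \<sigma> t))"

lemma sets_normal_law [simp, measurable_cong]: "sets (normal_law \<sigma>) = sets borel"
  and space_normal_law [simp]: "space (normal_law \<sigma>) = UNIV"
  by (simp_all add: normal_law_def)

lemma prob_space_normal_law: "\<sigma> > 0 \<Longrightarrow> prob_space (normal_law \<sigma>)"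
  unfolding normal_law_def by (rule prob_space_normal_density)

lemma char_normal_law:
  assumes "\<sigma> > 0"
  shows "char (normal_law \<sigma>) t = complex_of_real (exp (- (\<sigma> * t)\<^sup>2 / 2))"
proof -
  interpret prob_space "normal_law \<sigma>" using assms by (rule prob_space_normal_law)
  have "distributed (normal_law \<sigma>) lborel (\<lambda>x. x) (normal_density 0 \<sigma>)"
  proof -
    have "distr (normal_law \<sigma>) lborel (\<lambda>x. x) = normal_law \<sigma>"
      by (intro distr_id2) simp
    then show ?thesis by (simp add: distributed_def normal_law_def)
  qed
  then have "distributed (normal_law \<sigma>) lborel (\<lambda>x. x / \<sigma>) std_normal_density"
    using normal_standard_normal_convert[OF assms, of "\<lambda>x. x" 0] by simp
  then have D: "distr (normal_law \<sigma>) lborel (\<lambda>x. x / \<sigma>) = std_normal_distribution"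
    by (simp add: distributed_def)
  have "char (normal_law \<sigma>) t = (CLINT x|normal_law \<sigma>. iexp ((\<sigma> * t) * (x / \<sigma>)))"
    using assms by (simp add: char_def)
  also have "\<dots> = (CLINT x|distr (normal_law \<sigma>) lborel (\<lambda>x. x / \<sigma>). iexp ((\<sigma> * t) * x))"
    by (subst integral_distr) simp_all
  also have "\<dots> = char std_normal_distribution (\<sigma> * t)" by (simp only: D char_def)
  finally show ?thesis by (simp add: char_std_normal_distribution)
qed

text \<open>On three standard deviations around zero the density lies between its value at the ends and
  its maximum \<open>1 / sqrt (2 * pi) \<le> 1 / 2\<close>, both in units of the inverse deviation \<open>sqrt d\<close>.\<close>

lemma normal_law_interval_bounds:
  fixes d :: nat
  assumes d: "d \<ge> 1" and st: "-3 \<le> s" "s \<le> t" "t \<le> 3"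
  defines "I \<equiv> {s / sqrt d<..<t / sqrt d}"
  shows "exp (- 9 / 2) / sqrt (2 * pi) * (t - s) \<le> measure (normal_law (1 / sqrt d)) I"
    and "measure (normal_law (1 / sqrt d)) I \<le> (t - s) / 2"
proof -
  interpret prob_space "normal_law (1 / sqrt d)" using d by (intro prob_space_normal_law) simp
  let ?f = "normal_density 0 (1 / sqrt d)"
  have sd: "sqrt (real d) > 0" using d by simp
  have f: "?f x = sqrt d / sqrt (2 * pi) * exp (- (sqrt d * x)\<^sup>2 / 2)" for x
    using d by (simp add: normal_density_def power_divide power_mult_distrib real_sqrt_divide real_sqrt_mult field_simps)
  have lo: "sqrt d * (exp (- 9 / 2) / sqrt (2 * pi)) \<le> ?f x" if "x \<in> I" for x
  proof -
    have "s < sqrt d * x" "sqrt d * x < t" using that sd by (auto simp: I_def field_simps)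
    then have "\<bar>sqrt d * x\<bar> \<le> \<bar>3\<bar>" using st by linarith
    then have "(sqrt d * x)\<^sup>2 \<le> 3\<^sup>2" by (simp only: abs_le_square_iff)
    then have "exp (- 9 / 2) \<le> exp (- (sqrt d * x)\<^sup>2 / 2)" by simp
    then have "sqrt d / sqrt (2 * pi) * exp (- 9 / 2) \<le> sqrt d / sqrt (2 * pi) * exp (- (sqrt d * x)\<^sup>2 / 2)"
      by (intro mult_left_mono) auto
    then show ?thesis unfolding f by simp
  qed
  have up: "?f x \<le> sqrt d / 2" for x
  proof -
    have "sqrt 4 \<le> sqrt (2 * pi)" using pi_gt3 by (intro real_sqrt_le_mono) simp
    then have "2 \<le> sqrt (2 * pi)" by simp
    then have "sqrt d / sqrt (2 * pi) * exp (- (sqrt d * x)\<^sup>2 / 2) \<le> sqrt d / 2 * 1"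
      by (intro mult_mono divide_left_mono) auto
    then show ?thesis by (simp add: f)
  qed
  have emI: "emeasure lborel I = ennreal ((t - s) / sqrt d)"
    unfolding I_def using st sd
    by (subst emeasure_lborel_Ioo) (auto intro: divide_right_mono simp: diff_divide_distrib)
  have em: "emeasure (normal_law (1 / sqrt d)) I = (\<integral>\<^sup>+x. ennreal (?f x) * indicator I x \<partial>lborel)"
    unfolding normal_law_def by (rule emeasure_density) (auto simp: I_def)
  have "ennreal (exp (- 9 / 2) / sqrt (2 * pi) * (t - s)) =
      (\<integral>\<^sup>+x. ennreal (sqrt d * (exp (- 9 / 2) / sqrt (2 * pi))) * indicator I x \<partial>lborel)"
    using sd st by (subst nn_integral_cmult_indicator) (auto simp: I_def[symmetric] emI ennreal_mult[symmetric], simp add: I_def)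
  also have "\<dots> \<le> emeasure (normal_law (1 / sqrt d)) I"
    unfolding em by (intro nn_integral_mono) (auto simp: indicator_def intro!: ennreal_leI lo[simplified])
  finally show "exp (- 9 / 2) / sqrt (2 * pi) * (t - s) \<le> measure (normal_law (1 / sqrt d)) I"
    by (simp add: emeasure_eq_measure)
  have "emeasure (normal_law (1 / sqrt d)) I \<le> (\<integral>\<^sup>+x. ennreal (sqrt d / 2) * indicator I x \<partial>lborel)"
    unfolding em by (intro nn_integral_mono mult_right_mono ennreal_leI up) simp
  also have "\<dots> = ennreal ((t - s) / 2)"
    using sd st by (subst nn_integral_cmult_indicator) (auto simp: I_def[symmetric] emI ennreal_mult[symmetric], simp add: I_def)
  finally show "measure (normal_law (1 / sqrt d)) I \<le> (t - s) / 2"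
    using st by (simp add: emeasure_eq_measure)
qed

text \<open>No integration is needed: for \<open>\<bar>x\<bar> > r\<close> the density with deviation \<open>\<sigma>\<close> is pointwise at most the
  stated constant times the density with deviation \<open>sqrt 2 * \<sigma>\<close>, whose total mass is one.\<close>

lemma normal_law_tail:
  assumes "\<sigma> > 0" "r \<ge> 0"
  shows "measure (normal_law \<sigma>) {x. \<bar>x\<bar> > r} \<le> sqrt 2 * exp (- r\<^sup>2 / (4 * \<sigma>\<^sup>2))"
proof -
  interpret prob_space "normal_law \<sigma>" using assms by (intro prob_space_normal_law)
  interpret N2: prob_space "normal_law (sqrt 2 * \<sigma>)" using assms by (intro prob_space_normal_law) simp
  let ?A = "{x. \<bar>x\<bar> > r}" and ?c = "sqrt 2 * exp (- r\<^sup>2 / (4 * \<sigma>\<^sup>2))"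
  have le: "normal_density 0 \<sigma> x \<le> ?c * normal_density 0 (sqrt 2 * \<sigma>) x" if "x \<in> ?A" for x
  proof -
    have "\<bar>r\<bar> \<le> \<bar>x\<bar>" using that assms by simp
    then have "r\<^sup>2 \<le> x\<^sup>2" by (simp only: abs_le_square_iff)
    then have "x\<^sup>2 / (4 * \<sigma>\<^sup>2) \<ge> r\<^sup>2 / (4 * \<sigma>\<^sup>2)" by (intro divide_right_mono) auto
    then have "exp (- x\<^sup>2 / (2 * \<sigma>\<^sup>2)) \<le> exp (- r\<^sup>2 / (4 * \<sigma>\<^sup>2)) * exp (- x\<^sup>2 / (2 * (sqrt 2 * \<sigma>)\<^sup>2))"
      unfolding exp_add[symmetric] by (simp add: power_mult_distrib)
    moreover have sq: "sqrt 2 * (sqrt 2 * y) = 2 * y" for y :: real by (simp flip: mult.assoc)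
    ultimately show ?thesis
      using assms unfolding normal_density_def
      by (simp add: power_mult_distrib real_sqrt_mult field_simps) (simp add: sq)
  qed
  have "emeasure (normal_law \<sigma>) ?A = (\<integral>\<^sup>+x. ennreal (normal_density 0 \<sigma> x) * indicator ?A x \<partial>lborel)"
    unfolding normal_law_def by (rule emeasure_density) auto
  also have "\<dots> \<le> (\<integral>\<^sup>+x. ennreal ?c * ennreal (normal_density 0 (sqrt 2 * \<sigma>) x) \<partial>lborel)"
    by (intro nn_integral_mono) (auto simp: indicator_def ennreal_mult[symmetric] intro!: ennreal_leI le[simplified])
  also have "\<dots> = ennreal ?c * (\<integral>\<^sup>+x. ennreal (normal_density 0 (sqrt 2 * \<sigma>) x) \<partial>lborel)"
    by (rule nn_integral_cmult) simp
  also have "(\<integral>\<^sup>+x. ennreal (normal_density 0 (sqrt 2 * \<sigma>) x) \<partial>lborel) = emeasure (normal_law (sqrt 2 * \<sigma>)) UNIV"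
    unfolding normal_law_def by (subst emeasure_density) auto
  also have "\<dots> = 1" using N2.emeasure_space_1 by simp
  finally show ?thesis by (simp add: emeasure_eq_measure)
qed

section \<open>Gaussian vectors\<close>

lemma gaussian_vector_eq: "gaussian_vector d = (\<Pi>\<^sub>M k\<in>{..<d}. normal_law (1 / sqrt d))"
  by (simp add: gaussian_vector_def normal_law_def)

lemma sets_gaussian_vector [measurable_cong]: "sets (gaussian_vector d) = sets (\<Pi>\<^sub>M k\<in>{..<d}. borel)"
  unfolding gaussian_vector_eq by (intro sets_PiM_cong) simp_all

lemma prob_space_gaussian_vector: "d \<ge> 1 \<Longrightarrow> prob_space (gaussian_vector d)"
  unfolding gaussian_vector_eq by (intro prob_space_PiM prob_space_normal_law) simp

lemma measurable_inner_prod [measurable]: "(\<lambda>z. inner_prod d z v) \<in> borel_measurable (gaussian_vector d)"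
  unfolding inner_prod_def by measurable

lemma gaussian_vector_char:
  assumes d: "d \<ge> 1"
  shows "(CLINT z|gaussian_vector d. iexp (inner_prod d z v)) = exp (- (\<Sum>k<d. (v k)\<^sup>2) / (2 * d))"
proof -
  interpret P: product_prob_space "\<lambda>_. normal_law (1 / sqrt d)" "{..<d}"
    using d by (intro product_prob_spaceI prob_space_normal_law) simp
  have "(CLINT z|gaussian_vector d. iexp (inner_prod d z v)) =
      (CLINT z|gaussian_vector d. (\<Prod>k<d. iexp (v k * z k)))"
    unfolding inner_prod_def of_real_sum sum_distrib_left
    by (subst exp_sum) (simp_all add: mult.commute)
  also have "\<dots> = (\<Prod>k<d. CLINT y|normal_law (1 / sqrt d). iexp (v k * y))"
    unfolding gaussian_vector_eq
    by (rule P.product_integral_prod) (auto intro!: P.M.integrable_iexp)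
  also have "\<dots> = (\<Prod>k<d. complex_of_real (exp (- (1 / sqrt d * v k)\<^sup>2 / 2)))"
    using d char_normal_law[of "1 / sqrt d"] unfolding char_def by (intro prod.cong) simp_all
  also have "\<dots> = complex_of_real (exp (\<Sum>k<d. - (1 / sqrt d * v k)\<^sup>2 / 2))"
    by (simp add: exp_sum)
  also have "(\<Sum>k<d. - (1 / sqrt d * v k)\<^sup>2 / 2) = - (\<Sum>k<d. (v k)\<^sup>2) / (2 * d)"
    by (simp add: power_mult_distrib power_divide sum_negf sum_divide_distrib mult.commute)
  finally show ?thesis .
qed

lemma gaussian_vector_law:
  assumes d: "d \<ge> 1" and x: "(\<Sum>k<d. (x k)\<^sup>2) = 1"
  shows "distr (gaussian_vector d) borel (\<lambda>z. inner_prod d z x) = normal_law (1 / sqrt d)"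
proof (rule Levy_uniqueness)
  interpret prob_space "gaussian_vector d" using d by (rule prob_space_gaussian_vector)
  interpret N: prob_space "normal_law (1 / sqrt d)" using d by (intro prob_space_normal_law) simp
  show "real_distribution (distr (gaussian_vector d) borel (\<lambda>z. inner_prod d z x))" by simp
  show "real_distribution (normal_law (1 / sqrt d))" by unfold_locales simp_all
  show "char (distr (gaussian_vector d) borel (\<lambda>z. inner_prod d z x)) = char (normal_law (1 / sqrt d))"
  proof
    fix t
    have "char (distr (gaussian_vector d) borel (\<lambda>z. inner_prod d z x)) t =
        (CLINT z|gaussian_vector d. iexp (inner_prod d z (\<lambda>k. t * x k)))"
      by (simp add: char_def integral_distr) (simp add: inner_prod_def sum_distrib_left mult_ac)
    also have "\<dots> = exp (- t\<^sup>2 / (2 * d))"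
      using d by (simp add: gaussian_vector_char power_mult_distrib sum_distrib_left[symmetric] x)
    finally show "char (distr (gaussian_vector d) borel (\<lambda>z. inner_prod d z x)) t = char (normal_law (1 / sqrt d)) t"
      using d by (simp add: char_normal_law power_divide)
  qed
qed

lemma gaussian_vector_prob:
  assumes "d \<ge> 1" "(\<Sum>k<d. (x k)\<^sup>2) = 1" "A \<in> sets borel"
  shows "measure (gaussian_vector d) {z \<in> space (gaussian_vector d). inner_prod d z x \<in> A} =
    measure (normal_law (1 / sqrt d)) A"
proof -
  have "measure (normal_law (1 / sqrt d)) A =
     measure (gaussian_vector d) ((\<lambda>z. inner_prod d z x) -` A \<inter> space (gaussian_vector d))"
    unfolding gaussian_vector_law[OF assms(1,2), symmetric] using assms by (intro measure_distr) simp_all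
  also have "(\<lambda>z. inner_prod d z x) -` A \<inter> space (gaussian_vector d) =
     {z \<in> space (gaussian_vector d). inner_prod d z x \<in> A}" by auto
  finally show ?thesis by simp
qed

text \<open>This replaces rotation invariance: for orthonormal \<open>x\<close> and \<open>u\<close> the linear form
  \<open>s \<langle>z, x\<rangle> + t \<langle>z, u\<rangle>\<close> has squared coefficient norm \<open>s\<^sup>2 + t\<^sup>2\<close>, so the joint characteristic
  function factorises.\<close>

lemma gaussian_vector_orthonormal_prob:
  assumes d: "d \<ge> 1" and x: "(\<Sum>k<d. (x k)\<^sup>2) = 1" and u: "(\<Sum>k<d. (u k)\<^sup>2) = 1"
    and orth: "inner_prod d x u = 0" and AB: "A \<in> sets borel" "B \<in> sets borel"
  shows "measure (gaussian_vector d) {z \<in> space (gaussian_vector d). inner_prod d z x \<in> A \<and> inner_prod d z u \<in> B} =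
    measure (normal_law (1 / sqrt d)) A * measure (normal_law (1 / sqrt d)) B"
proof -
  interpret prob_space "gaussian_vector d" using d by (rule prob_space_gaussian_vector)
  have comb: "s * inner_prod d z x + t * inner_prod d z u = inner_prod d z (\<lambda>k. s * x k + t * u k)" for s t z
    by (simp add: inner_prod_def sum_distrib_left sum.distrib algebra_simps)
  have sq: "(\<Sum>k<d. (s * x k + t * u k)\<^sup>2) = s\<^sup>2 + t\<^sup>2" for s t
  proof -
    have "(\<Sum>k<d. (s * x k + t * u k)\<^sup>2) =
       s\<^sup>2 * (\<Sum>k<d. (x k)\<^sup>2) + t\<^sup>2 * (\<Sum>k<d. (u k)\<^sup>2) + 2 * s * t * inner_prod d x u"
      by (simp add: inner_prod_def sum_distrib_left sum.distrib power2_eq_square algebra_simps)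
    then show ?thesis by (simp add: x u orth)
  qed
  have c: "expectation (\<lambda>z. iexp (s * inner_prod d z x + t * inner_prod d z u)) = exp (- (s\<^sup>2 + t\<^sup>2) / (2 * d))" for s t
    unfolding comb using gaussian_vector_char[OF d, of "\<lambda>k. s * x k + t * u k"] by (simp only: sq)
  have "expectation (\<lambda>z. iexp (s * inner_prod d z x + t * inner_prod d z u)) =
     expectation (\<lambda>z. iexp (s * inner_prod d z x)) * expectation (\<lambda>z. iexp (t * inner_prod d z u))" for s t
    using c[of s 0] c[of 0 t] unfolding c[of s t]
    by (simp add: exp_add[symmetric] exp_of_real[symmetric] add_divide_distrib[symmetric] diff_divide_distrib)
  from indep_of_char_factorization[OF _ _ this AB] show ?thesis
    by (simp add: gaussian_vector_prob[OF d x AB(1)] gaussian_vector_prob[OF d u AB(2)])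
qed

section \<open>Counts in independent samples\<close>

lemma (in prob_space) power_prob_all_avoid:
  assumes I: "finite I" and A: "A \<in> sets M"
  shows "measure (\<Pi>\<^sub>M i\<in>I. M) {g \<in> space (\<Pi>\<^sub>M i\<in>I. M). \<forall>i\<in>I. g i \<notin> A} = (1 - prob A) ^ card I"
proof -
  interpret P: finite_product_prob_space "\<lambda>_. M" I
    by unfold_locales fact
  have "{g \<in> space (\<Pi>\<^sub>M i\<in>I. M). \<forall>i\<in>I. g i \<notin> A} = (\<Pi>\<^sub>E i\<in>I. space M - A)"
    by (auto simp: space_PiM PiE_def Pi_def)
  then show ?thesis
    using A by (simp add: P.finite_measure_PiM_emb prob_compl)
qed

lemma (in prob_space) power_measurable_card [measurable]:
  assumes I: "finite I" and [measurable]: "A \<in> sets M"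
  shows "(\<lambda>g. card {i \<in> I. g i \<in> A}) \<in> measurable (\<Pi>\<^sub>M i\<in>I. M) (count_space UNIV)"
proof -
  have "(\<lambda>g. card {i \<in> I. g i \<in> A}) = (\<lambda>g. \<Sum>i\<in>I. if g i \<in> A then 1 else 0)"
    using I by (simp add: sum.If_cases Int_def)
  then show ?thesis by simp
qed

text \<open>The exponential of a count is a product of functions of single coordinates; the bound then
  is \<open>1 + y \<le> exp y\<close> in each factor.\<close>

lemma (in prob_space) power_exp_card:
  fixes l :: real
  assumes I: "finite I" and [measurable]: "A \<in> sets M"
  shows "(\<integral>\<^sup>+g. ennreal (exp (l * card {i \<in> I. g i \<in> A})) \<partial>(\<Pi>\<^sub>M i\<in>I. M)) \<le>
    ennreal (exp (card I * prob A * (exp l - 1)))"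
proof -
  interpret P: finite_product_prob_space "\<lambda>_. M" I
    by unfold_locales fact
  have "(\<integral>\<^sup>+g. ennreal (exp (l * card {i \<in> I. g i \<in> A})) \<partial>(\<Pi>\<^sub>M i\<in>I. M)) =
     (\<integral>\<^sup>+g. (\<Prod>i\<in>I. ennreal (exp (l * indicat_real A (g i)))) \<partial>(\<Pi>\<^sub>M i\<in>I. M))"
  proof (intro nn_integral_cong)
    fix g :: "'b \<Rightarrow> 'a"
    have "real (card {i \<in> I. g i \<in> A}) = (\<Sum>i\<in>I. indicat_real A (g i))"
      using I by (simp add: indicator_def sum.If_cases Int_def)
    then have "l * card {i \<in> I. g i \<in> A} = (\<Sum>i\<in>I. l * indicat_real A (g i))"
      by (simp only: sum_distrib_left)
    then have "exp (l * card {i \<in> I. g i \<in> A}) = (\<Prod>i\<in>I. exp (l * indicat_real A (g i)))"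
      by (simp only: exp_sum[OF I])
    then show "ennreal (exp (l * card {i \<in> I. g i \<in> A})) = (\<Prod>i\<in>I. ennreal (exp (l * indicat_real A (g i))))"
      by (simp add: prod_ennreal)
  qed
  also have "\<dots> = (\<Prod>i\<in>I. \<integral>\<^sup>+z. ennreal (exp (l * indicat_real A z)) \<partial>M)"
    by (rule P.product_nn_integral_prod[OF I]) simp
  also have "(\<integral>\<^sup>+z. ennreal (exp (l * indicat_real A z)) \<partial>M) = ennreal (1 + prob A * (exp l - 1))"
  proof -
    have "(\<integral>\<^sup>+z. ennreal (exp (l * indicat_real A z)) \<partial>M) =
        ennreal (expectation (\<lambda>z. exp (l * indicat_real A z)))"
      by (intro nn_integral_eq_integral integrable_const_bound[of _ "max 1 (exp l)"]) (auto simp: indicator_def)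
    also have "expectation (\<lambda>z. exp (l * indicat_real A z)) = expectation (\<lambda>z. 1 + (exp l - 1) * indicat_real A z)"
      by (intro Bochner_Integration.integral_cong) (auto simp: indicator_def)
    also have "\<dots> = 1 + prob A * (exp l - 1)"
      using integrable_const_bound[of "indicat_real A" 1]
      by (subst Bochner_Integration.integral_add)
         (auto simp: prob_space indicator_le_1 sets.Int_space_eq2[OF assms(2)])
    finally show ?thesis .
  qed
  also have "(\<Prod>i\<in>I. ennreal (1 + prob A * (exp l - 1))) \<le> ennreal (exp (card I * prob A * (exp l - 1)))"
  proof -
    have "0 \<le> (1 - prob A) + prob A * exp l" by (intro add_nonneg_nonneg) auto
    then have nn: "0 \<le> 1 + prob A * (exp l - 1)" by (simp add: algebra_simps)
    have "(1 + prob A * (exp l - 1)) ^ card I \<le> exp (prob A * (exp l - 1)) ^ card I"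
      using nn by (intro power_mono) auto
    then show ?thesis
      using nn by (simp add: ennreal_power exp_of_nat_mult[symmetric] mult_ac ennreal_leI)
  qed
  finally show ?thesis .
qed

text \<open>Chernoff bounds of multiplicative type, from the exponential moments of order \<open>1\<close> and \<open>- 1\<close>.
  Additive deviation bounds would be too weak for an \<open>A\<close> whose probability tends to zero as
  \<open>card I\<close> grows, such as a narrow window.\<close>

lemma (in prob_space) power_count_tails:
  assumes I: "finite I" and A [measurable]: "A \<in> sets M"
  defines "m \<equiv> card I * prob A"
  shows "measure (\<Pi>\<^sub>M i\<in>I. M) {g \<in> space (\<Pi>\<^sub>M i\<in>I. M). real (card {i \<in> I. g i \<in> A}) \<ge> 3 * m}
      \<le> exp (- m)"
    and "measure (\<Pi>\<^sub>M i\<in>I. M) {g \<in> space (\<Pi>\<^sub>M i\<in>I. M). real (card {i \<in> I. g i \<in> A}) \<le> m / 2}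
      \<le> exp (- m / 10)"
proof -
  interpret P: finite_product_prob_space "\<lambda>_. M" I
    by unfold_locales fact
  note [measurable] = power_measurable_card[OF I A]
  have m: "m \<ge> 0" by (simp add: m_def)
  have drop: "(\<integral>\<^sup>+g. ennreal (exp (l * real (card {i \<in> I. g i \<in> A}))) * indicator (space (\<Pi>\<^sub>M i\<in>I. M)) g \<partial>(\<Pi>\<^sub>M i\<in>I. M))
      \<le> ennreal (exp (m * (exp l - 1)))" for l :: real
    using power_exp_card[OF I A, of l] by (simp add: m_def cong: nn_integral_cong)
  have "emeasure (\<Pi>\<^sub>M i\<in>I. M) {g \<in> space (\<Pi>\<^sub>M i\<in>I. M). real (card {i \<in> I. g i \<in> A}) \<ge> 3 * m}
     \<le> ennreal (exp (- 1 * (3 * m))) * ennreal (exp (m * (exp 1 - 1)))"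
    by (rule order_trans[OF Chernoff_ineq_nn_integral_ge[where s=1]])
       (use drop[of 1] in \<open>auto intro!: mult_left_mono\<close>)
  also have "\<dots> = ennreal (exp (m * (exp 1 - 4)))"
    by (simp add: ennreal_mult[symmetric] exp_add[symmetric] algebra_simps)
  also have "\<dots> \<le> ennreal (exp (- m))"
  proof (intro ennreal_leI)
    have "m * (exp 1 - 4) \<le> m * (- 1)" using exp_le m by (intro mult_left_mono) auto
    then show "exp (m * (exp 1 - 4)) \<le> exp (- m)" by simp
  qed
  finally show "measure (\<Pi>\<^sub>M i\<in>I. M) {g \<in> space (\<Pi>\<^sub>M i\<in>I. M). real (card {i \<in> I. g i \<in> A}) \<ge> 3 * m}
      \<le> exp (- m)"
    by (simp add: P.emeasure_eq_measure)
  have e: "exp (- 1) \<le> (2 / 5 :: real)"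
  proof -
    have "5 / 2 \<le> (exp 1 :: real)" using exp_lower_Taylor_quadratic[of "1::real"] by simp
    then have "inverse (exp 1) \<le> inverse (5 / 2 :: real)" by (intro le_imp_inverse_le) auto
    then show ?thesis by (simp add: exp_minus)
  qed
  have "emeasure (\<Pi>\<^sub>M i\<in>I. M) {g \<in> space (\<Pi>\<^sub>M i\<in>I. M). real (card {i \<in> I. g i \<in> A}) \<le> m / 2}
     \<le> ennreal (exp (1 * (m / 2))) * ennreal (exp (m * (exp (- 1) - 1)))"
    by (rule order_trans[OF Chernoff_ineq_nn_integral_le[where s=1]])
       (use drop[of "-1"] in \<open>auto intro!: mult_left_mono\<close>)
  also have "\<dots> = ennreal (exp (m * (exp (- 1) - 1 / 2)))"
    by (simp add: ennreal_mult[symmetric] exp_add[symmetric] algebra_simps)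
  also have "\<dots> \<le> ennreal (exp (- m / 10))"
  proof (intro ennreal_leI)
    have "m * (exp (- 1) - 1 / 2) \<le> m * (- (1 / 10))" using e m by (intro mult_left_mono) auto
    then show "exp (m * (exp (- 1) - 1 / 2)) \<le> exp (- m / 10)" by simp
  qed
  finally show "measure (\<Pi>\<^sub>M i\<in>I. M) {g \<in> space (\<Pi>\<^sub>M i\<in>I. M). real (card {i \<in> I. g i \<in> A}) \<le> m / 2}
      \<le> exp (- m / 10)"
    by (simp add: P.emeasure_eq_measure)
qed

section \<open>Measurability of the consistency event\<close>

text \<open>Projections of measurable sets need not be measurable; along a compact set and for a function
  continuous in the projected variable they are, because the minimum is attained and its sign can
  be tested on a countable dense subset.\<close>

lemma measurable_exists_compact:
  fixes F :: "'a \<Rightarrow> 'b::{metric_space, second_countable_topology} \<Rightarrow> real"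
  assumes K: "compact K"
    and meas: "\<And>y. y \<in> K \<Longrightarrow> (\<lambda>\<omega>. F \<omega> y) \<in> borel_measurable M"
    and cont: "\<And>\<omega>. \<omega> \<in> space M \<Longrightarrow> continuous_on K (F \<omega>)"
  shows "{\<omega> \<in> space M. \<exists>y\<in>K. F \<omega> y \<le> 0} \<in> sets M"
proof -
  obtain D where D: "countable D" "D \<subseteq> K" "K \<subseteq> closure D"
    by (rule separable)
  have "(\<exists>y\<in>K. F \<omega> y \<le> 0) \<longleftrightarrow> (\<forall>n::nat. \<exists>y\<in>D. F \<omega> y < 1 / Suc n)" if \<omega>: "\<omega> \<in> space M" for \<omega>
  proof safe
    fix y n assume y: "y \<in> K" "F \<omega> y \<le> 0"
    have "continuous (at y within K) (F \<omega>)"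
      using cont[OF \<omega>] y by (simp add: continuous_on_eq_continuous_within)
    moreover have "(0::real) < 1 / Suc n" by simp
    ultimately obtain \<delta> where \<delta>: "\<delta> > 0" "\<And>z. z \<in> K \<Longrightarrow> dist z y < \<delta> \<Longrightarrow> dist (F \<omega> z) (F \<omega> y) < 1 / Suc n"
      unfolding continuous_within_eps_delta by meson
    obtain z where z: "z \<in> D" "dist z y < \<delta>"
      using D y \<delta>(1) unfolding closure_approachable by (metis closure_approachable subsetD)
    then have "dist (F \<omega> z) (F \<omega> y) < 1 / Suc n" using \<delta>(2) D by blast
    then have "F \<omega> z < 1 / Suc n" using y unfolding dist_real_def by linarith
    with z show "\<exists>y\<in>D. F \<omega> y < 1 / Suc n" by blast
  next
    assume *: "\<forall>n::nat. \<exists>y\<in>D. F \<omega> y < 1 / Suc n"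
    then have "K \<noteq> {}" using D by blast
    then obtain y where y: "y \<in> K" "\<And>z. z \<in> K \<Longrightarrow> F \<omega> y \<le> F \<omega> z"
      using continuous_attains_inf[OF K _ cont[OF \<omega>]] by blast
    have "F \<omega> y \<le> 0"
    proof (rule ccontr)
      assume "\<not> F \<omega> y \<le> 0"
      then obtain n :: nat where "1 / Suc n < F \<omega> y"
        using nat_approx_posE[of "F \<omega> y"] by (auto simp: not_le)
      moreover obtain z where "z \<in> D" "F \<omega> z < 1 / Suc n" using * by blast
      ultimately show False using y(2)[of z] D(2) by force
    qed
    with y show "\<exists>y\<in>K. F \<omega> y \<le> 0" by blast
  qed
  then have "{\<omega> \<in> space M. \<exists>y\<in>K. F \<omega> y \<le> 0} =
      {\<omega> \<in> space M. \<forall>n::nat. \<exists>y\<in>D. F \<omega> y < 1 / Suc n}" by blast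
  also have "\<dots> = (\<Inter>n::nat. \<Union>y\<in>D. {\<omega> \<in> space M. F \<omega> y < 1 / Suc n}) \<inter> space M" by auto
  also have "\<dots> \<in> sets M"
  proof -
    have "{\<omega> \<in> space M. F \<omega> y < 1 / Suc n} \<in> sets M" if "y \<in> D" for y n
    proof -
      have [measurable]: "(\<lambda>\<omega>. F \<omega> y) \<in> borel_measurable M" using meas that D(2) by blast
      show ?thesis by measurable
    qed
    then have "(\<Union>y\<in>D. {\<omega> \<in> space M. F \<omega> y < 1 / Suc n}) \<in> sets M" for n :: nat
      using D(1) by (intro sets.countable_UN') auto
    then show ?thesis by (intro sets.Int sets.countable_INT) auto
  qed
  finally show ?thesis .
qed

lemma continuous_on_inner_prod [continuous_intros]: "continuous_on K (\<lambda>y. inner_prod d z y)"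
  unfolding inner_prod_def
  by (intro continuous_intros continuous_on_subset[OF continuous_on_product_coordinates]) auto

lemma norm2_eq_sqrt: "norm2 d u = sqrt (\<Sum>k<d. (u k)\<^sup>2)"
  by (simp add: norm2_def L2_set_def)

lemma continuous_on_norm2_diff [continuous_intros]: "continuous_on K (\<lambda>y. norm2 d (\<lambda>k. x k - y k))"
  unfolding norm2_eq_sqrt
  by (intro continuous_intros continuous_on_subset[OF continuous_on_product_coordinates]) auto

lemma compact_unit_sphere: "compact (unit_sphere d)"
proof -
  let ?S = "\<lambda>k. if k < d then {-1..1::real} else {undefined}"
  have "compactin (product_topology (\<lambda>_::nat. euclidean :: real topology) UNIV) (PiE UNIV ?S)"
    unfolding compactin_PiE by auto
  then have c: "compact (PiE UNIV ?S)"
    by (simp add: euclidean_product_topology)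
  have "closed {u :: nat \<Rightarrow> real. norm2 d (\<lambda>k. 0 - u k) = 1}"
    by (intro closed_Collect_eq continuous_intros)
  moreover have "unit_sphere d = PiE UNIV ?S \<inter> {u. norm2 d (\<lambda>k. 0 - u k) = 1}"
  proof -
    have "-1 \<le> u k \<and> u k \<le> 1" if "norm2 d u = 1" "k < d" for u k
    proof -
      have "(u k)\<^sup>2 \<le> (\<Sum>k<d. (u k)\<^sup>2)" using that(2) by (intro member_le_sum) auto
      then have "\<bar>u k\<bar> \<le> 1" using that(1) by (simp add: norm2_eq_sqrt abs_square_le_1)
      then show ?thesis by linarith
    qed
    moreover have "norm2 d (\<lambda>k. 0 - u k) = norm2 d u" for u by (simp add: norm2_eq_sqrt)
    ultimately show ?thesis
      by (auto simp: unit_sphere_def PiE_def Pi_def extensional_def)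
  qed
  ultimately show ?thesis using c by (simp add: compact_Int_closed)
qed

text \<open>For given \<open>p\<close>, agreement of the signs of \<open>p\<close> and \<open>q\<close> is an open condition on \<open>q\<close> if \<open>p \<noteq> 0\<close> and a
  closed one if \<open>p = 0\<close>. It is the increasing union over \<open>n\<close> of the conditions \<open>v n p q = 0\<close>, closed
  in \<open>q\<close>, which ask for \<open>q = 0\<close> if \<open>p = 0\<close> and otherwise for \<open>q\<close> to be at least \<open>1 / Suc n\<close> in the
  direction of \<open>p\<close>. The strict distance condition is exhausted in the same way, and each stage
  falls under \<open>measurable_exists_compact\<close>.\<close>

lemma measurable_exists_consistent:
  fixes a :: "'i \<Rightarrow> 'a \<Rightarrow> real"
  assumes J: "finite J"
    and a: "\<And>i. i \<in> J \<Longrightarrow> a i \<in> borel_measurable M"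
    and b: "\<And>i y. i \<in> J \<Longrightarrow> (\<lambda>\<omega>. inner_prod d (G i \<omega>) y) \<in> borel_measurable M"
  shows "{\<omega> \<in> space M. \<exists>y\<in>unit_sphere d. \<rho> < norm2 d (\<lambda>k. x k - y k) \<and>
           (\<forall>i\<in>J. sgn (a i \<omega>) = sgn (inner_prod d (G i \<omega>) y))} \<in> sets M"
proof -
  define v where "v n p q = (if p = 0 then \<bar>q\<bar> else max 0 (1 / Suc n - sgn p * q))" for n and p q :: real
  define F where "F n \<omega> y = (\<Sum>i\<in>J. v n (a i \<omega>) (inner_prod d (G i \<omega>) y))
      + max 0 (\<rho> + 1 / Suc n - norm2 d (\<lambda>k. x k - y k))" for n \<omega> y
  have v0: "v n p q \<ge> 0" for n p q by (simp add: v_def)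
  have vsgn: "sgn p = sgn q" if "v n p q = 0" for n p q
  proof (cases "p = 0")
    case False
    then have "sgn p * q \<ge> 1 / Suc n" using that by (simp add: v_def max_def split: if_splits)
    moreover have "(1::real) / Suc n > 0" by simp
    ultimately have "sgn p * q > 0" by linarith
    then show ?thesis using False by (auto simp: sgn_if split: if_splits)
  qed (use that in \<open>simp add: v_def\<close>)
  have small: "\<forall>\<^sub>F n in sequentially. 1 / Suc n < e" if "e > 0" for e :: real
    using order_tendstoD(2)[OF LIMSEQ_inverse_real_of_nat that] by (simp add: inverse_eq_divide)
  have vev: "\<forall>\<^sub>F n in sequentially. v n p q = 0" if "sgn p = sgn q" for p q
  proof (cases "p = 0")
    case True
    with that have "q = 0" by (simp add: sgn_0_0)
    with True show ?thesis by (simp add: v_def)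
  next
    case False
    then have "sgn p * q > 0" using that by (auto simp: sgn_if split: if_splits)
    from small[OF this] show ?thesis
      by eventually_elim (use False in \<open>simp add: v_def\<close>)
  qed
  have eq: "(\<exists>y\<in>unit_sphere d. \<rho> < norm2 d (\<lambda>k. x k - y k) \<and>
           (\<forall>i\<in>J. sgn (a i \<omega>) = sgn (inner_prod d (G i \<omega>) y))) \<longleftrightarrow>
         (\<exists>n. \<exists>y\<in>unit_sphere d. F n \<omega> y \<le> 0)" for \<omega>
  proof safe
    fix y assume y: "y \<in> unit_sphere d" "\<rho> < norm2 d (\<lambda>k. x k - y k)"
      "\<forall>i\<in>J. sgn (a i \<omega>) = sgn (inner_prod d (G i \<omega>) y)"
    have "\<forall>\<^sub>F n in sequentially. \<forall>i\<in>J. v n (a i \<omega>) (inner_prod d (G i \<omega>) y) = 0"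
      using y(3) vev by (intro eventually_ball_finite[OF J]) auto
    moreover have "\<forall>\<^sub>F n in sequentially. 1 / Suc n < norm2 d (\<lambda>k. x k - y k) - \<rho>"
      using y(2) by (intro small) simp
    ultimately have "\<forall>\<^sub>F n in sequentially. F n \<omega> y \<le> 0"
      by eventually_elim (simp add: F_def)
    then obtain n where "F n \<omega> y \<le> 0"
      by (auto simp: eventually_sequentially)
    with y(1) show "\<exists>n. \<exists>y\<in>unit_sphere d. F n \<omega> y \<le> 0" by blast
  next
    fix n y assume y: "y \<in> unit_sphere d" "F n \<omega> y \<le> 0"
    let ?s = "\<Sum>i\<in>J. v n (a i \<omega>) (inner_prod d (G i \<omega>) y)"
    have s: "?s \<ge> 0" by (intro sum_nonneg v0)
    then have "?s = 0" and *: "\<rho> + 1 / Suc n - norm2 d (\<lambda>k. x k - y k) \<le> 0"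
      using y(2) unfolding F_def by linarith+
    then have "\<forall>i\<in>J. v n (a i \<omega>) (inner_prod d (G i \<omega>) y) = 0"
      using J v0 by (simp add: sum_nonneg_eq_0_iff)
    then have "\<forall>i\<in>J. sgn (a i \<omega>) = sgn (inner_prod d (G i \<omega>) y)" using vsgn by blast
    moreover have "(1::real) / Suc n > 0" by simp
    then have "\<rho> < norm2 d (\<lambda>k. x k - y k)" using * by linarith
    ultimately show "\<exists>y\<in>unit_sphere d. \<rho> < norm2 d (\<lambda>k. x k - y k) \<and>
           (\<forall>i\<in>J. sgn (a i \<omega>) = sgn (inner_prod d (G i \<omega>) y))" using y(1) by blast
  qed
  have "{\<omega> \<in> space M. \<exists>y\<in>unit_sphere d. F n \<omega> y \<le> 0} \<in> sets M" for n
  proof (rule measurable_exists_compact[OF compact_unit_sphere])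
    show "(\<lambda>\<omega>. F n \<omega> y) \<in> borel_measurable M" for y
      unfolding F_def v_def using a b[of _ y] by measurable
    have "continuous_on (unit_sphere d) (\<lambda>y. v n p (inner_prod d z y))" for p z
      unfolding v_def by (cases "p = 0") (auto intro!: continuous_intros)
    then show "continuous_on (unit_sphere d) (F n \<omega>)" for \<omega>
      unfolding F_def by (intro continuous_intros) auto
  qed
  then have "(\<Union>n. {\<omega> \<in> space M. \<exists>y\<in>unit_sphere d. F n \<omega> y \<le> 0}) \<in> sets M" by auto
  also have "(\<Union>n. {\<omega> \<in> space M. \<exists>y\<in>unit_sphere d. F n \<omega> y \<le> 0}) =
     {\<omega> \<in> space M. \<exists>y\<in>unit_sphere d. \<rho> < norm2 d (\<lambda>k. x k - y k) \<and>
           (\<forall>i\<in>J. sgn (a i \<omega>) = sgn (inner_prod d (G i \<omega>) y))}"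
    by (auto simp: eq)
  finally show ?thesis .
qed

lemma measurable_sample_component [measurable]:
  "i \<in> {1..M} \<Longrightarrow> (\<lambda>g. g i) \<in> measurable (gaussian_sample d M) (gaussian_vector d)"
  unfolding gaussian_sample_def by (rule measurable_component_singleton)

lemma measurable_sample_inner_prod [measurable]:
  "i \<in> {1..M} \<Longrightarrow> (\<lambda>g. inner_prod d (g i) v) \<in> borel_measurable (gaussian_sample d M)"
  by (rule measurable_compose[OF measurable_sample_component measurable_inner_prod])

lemma prob_space_gaussian_sample: "d \<ge> 1 \<Longrightarrow> prob_space (gaussian_sample d M)"
  unfolding gaussian_sample_def by (intro prob_space_PiM prob_space_gaussian_vector)

lemma window_subset: "window d M \<tau> x g \<subseteq> {1..M}"
  by (auto simp: window_def)

text \<open>The index set takes finitely many values \<open>J\<close>; on the part of the sample space where it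
  equals \<open>J\<close> the event is the complement of an existence statement over the compact sphere.\<close>

lemma measurable_event:
  assumes V: "V \<subseteq> {1..M}"
  shows "{g \<in> space (gaussian_sample d M).
      lo \<le> real (card (window d M \<tau> x g \<union> V)) \<and> real (card (window d M \<tau> x g \<union> V)) \<le> hi \<and>
      (\<forall>y\<in>unit_sphere d. (\<forall>i\<in>window d M \<tau> x g \<union> V.
          sgn (inner_prod d (g i) x) = sgn (inner_prod d (g i) y)) \<longrightarrow> norm2 d (\<lambda>k. x k - y k) \<le> \<rho>)}
    \<in> sets (gaussian_sample d M)" (is "?E \<in> sets ?P")
proof -
  define JJ where "JJ = {J. J \<subseteq> {1..M} \<and> lo \<le> real (card J) \<and> real (card J) \<le> hi}"
  define U where "U J = {g \<in> space ?P. window d M \<tau> x g \<union> V = J}" for J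
  define Z where "Z J = {g \<in> space ?P. \<exists>y\<in>unit_sphere d. \<rho> < norm2 d (\<lambda>k. x k - y k) \<and>
      (\<forall>i\<in>J. sgn (inner_prod d (g i) x) = sgn (inner_prod d (g i) y))}" for J
  have "?E = (\<Union>J\<in>JJ. U J - Z J)"
  proof (intro set_eqI iffI)
    fix g assume g: "g \<in> ?E"
    then have "g \<in> U (window d M \<tau> x g \<union> V) - Z (window d M \<tau> x g \<union> V)"
      by (fastforce simp: U_def Z_def)
    moreover have "window d M \<tau> x g \<union> V \<in> JJ"
      using g V window_subset by (auto simp: JJ_def)
    ultimately show "g \<in> (\<Union>J\<in>JJ. U J - Z J)" by blast
  next
    fix g assume "g \<in> (\<Union>J\<in>JJ. U J - Z J)"
    then show "g \<in> ?E" by (fastforce simp: U_def Z_def JJ_def not_le)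
  qed
  also have "\<dots> \<in> sets ?P"
  proof (intro sets.finite_UN sets.Diff)
    show "finite JJ" by (rule finite_subset[of _ "Pow {1..M}"]) (auto simp: JJ_def)
    fix J assume J: "J \<in> JJ"
    have "U J = {g \<in> space ?P. \<forall>i\<in>{1..M}. i \<in> J \<longleftrightarrow>
        (- \<tau> < inner_prod d (g i) x \<and> inner_prod d (g i) x < 0) \<or> i \<in> V}"
      using J V unfolding U_def JJ_def window_def by blast
    also have "\<dots> \<in> sets ?P" by measurable
    finally show "U J \<in> sets ?P" .
    show "Z J \<in> sets ?P"
      unfolding Z_def using J
      by (intro measurable_exists_consistent measurable_sample_inner_prod) (auto simp: JJ_def finite_subset)
  qed
  finally show ?thesis .
qed

section \<open>Discretising directions\<close>

text \<open>One point of \<open>T\<close> is chosen from each occupied cell of a grid of width \<open>\<eta>\<close>. Taking net points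
  from \<open>T\<close> itself keeps them unit vectors orthogonal to \<open>x\<close> in the application, which independence
  requires.\<close>

lemma cube_net:
  fixes T :: "(nat \<Rightarrow> real) set"
  assumes T: "\<forall>u\<in>T. \<forall>k<d. \<bar>u k\<bar> \<le> 1" and \<eta>: "0 < \<eta>" "\<eta> \<le> 1"
  obtains N where "N \<subseteq> T" "finite N" "real (card N) \<le> (5 / \<eta>) ^ d"
    "\<forall>u\<in>T. \<exists>v\<in>N. \<forall>k<d. \<bar>u k - v k\<bar> \<le> \<eta>"
proof -
  define f where "f u = restrict (\<lambda>k. \<lfloor>u k / \<eta>\<rfloor>) {..<d}" for u
  define m where "m = \<lceil>1 / \<eta>\<rceil>"
  have "1 / \<eta> \<ge> 0" using \<eta> by simp
  then have m: "m \<ge> 0" unfolding m_def by linarith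
  define N where "N = (\<lambda>z. SOME u. u \<in> T \<and> f u = z) ` (f ` T)"
  have sub: "f ` T \<subseteq> (\<Pi>\<^sub>E k\<in>{..<d}. {-m..m})"
  proof -
    have "\<lfloor>u k / \<eta>\<rfloor> \<in> {-m..m}" if u: "u \<in> T" "k < d" for u k
    proof -
    have "- (1 / \<eta>) \<le> u k / \<eta>" "u k / \<eta> \<le> 1 / \<eta>"
      using T u \<eta> by (auto simp: abs_le_iff field_simps)
    then have "\<lfloor>- (1 / \<eta>)\<rfloor> \<le> \<lfloor>u k / \<eta>\<rfloor>" "\<lfloor>u k / \<eta>\<rfloor> \<le> \<lfloor>1 / \<eta>\<rfloor>"
      by (intro floor_mono; simp)+
    moreover have "\<lfloor>- (1 / \<eta>)\<rfloor> = - m" "\<lfloor>1 / \<eta>\<rfloor> \<le> m"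
      unfolding m_def by (simp_all add: floor_minus)
    ultimately show ?thesis by auto
    qed
    then have "f u \<in> (\<Pi>\<^sub>E k\<in>{..<d}. {-m..m})" if "u \<in> T" for u
      unfolding f_def using that by (subst restrict_PiE_iff) blast
    then show ?thesis by blast
  qed
  have fin: "finite (\<Pi>\<^sub>E k\<in>{..<d}. {-m..m})" by (intro finite_PiE) auto
  have "card N \<le> card (f ` T)"
    unfolding N_def using finite_subset[OF sub fin] by (rule card_image_le)
  also have "\<dots> \<le> card (\<Pi>\<^sub>E k\<in>{..<d}. {-m..m})" by (rule card_mono[OF fin sub])
  also have "\<dots> = nat (2 * m + 1) ^ d" by (simp add: card_PiE)
  finally have "real (card N) \<le> real (nat (2 * m + 1) ^ d)" by (simp only: of_nat_le_iff)
  also have "\<dots> = (2 * real_of_int m + 1) ^ d" using m by simp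
  also have "\<dots> \<le> (5 / \<eta>) ^ d"
  proof (intro power_mono)
    have "m \<le> 1 / \<eta> + 1" unfolding m_def by linarith
    moreover have "1 \<le> 1 / \<eta>" using \<eta> by simp
    ultimately have "2 * real_of_int m + 1 \<le> 5 * (1 / \<eta>)" by linarith
    then show "2 * real_of_int m + 1 \<le> 5 / \<eta>" by simp
  qed (use m in simp)
  finally have "real (card N) \<le> (5 / \<eta>) ^ d" .
  moreover have "finite N" unfolding N_def using finite_subset[OF sub fin] by blast
  moreover have some: "(SOME v. v \<in> T \<and> f v = f u) \<in> T \<and> f (SOME v. v \<in> T \<and> f v = f u) = f u" if "u \<in> T" for u
    by (rule someI[of _ u]) (simp add: that)
  then have "N \<subseteq> T" unfolding N_def by blast
  moreover have "\<exists>v\<in>N. \<forall>k<d. \<bar>u k - v k\<bar> \<le> \<eta>" if u: "u \<in> T" for u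
  proof -
    define v where "v = (SOME v. v \<in> T \<and> f v = f u)"
    have v: "f v = f u" "v \<in> N" using some[OF u] u unfolding v_def N_def by auto
    have "\<bar>u k - v k\<bar> \<le> \<eta>" if "k < d" for k
    proof -
      have "\<lfloor>u k / \<eta>\<rfloor> = \<lfloor>v k / \<eta>\<rfloor>"
        using fun_cong[OF v(1), of k] that by (simp add: f_def)
      then have "\<bar>u k / \<eta> - v k / \<eta>\<bar> \<le> 1" by linarith
      then have "\<bar>u k - v k\<bar> / \<eta> \<le> 1"
        using \<eta> by (simp add: diff_divide_distrib[symmetric] abs_divide)
      then show ?thesis using \<eta> by simp
    qed
    with v show ?thesis by blast
  qed
  ultimately show ?thesis using that by blast
qed

section \<open>Consistent points are close\<close>

text \<open>The deterministic heart. Write \<open>y = t x + s u\<close> with \<open>u\<close> a unit vector orthogonal to \<open>x\<close> and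
  \<open>s \<ge> 0\<close>. A window vector with \<open>\<langle>g\<^sub>i, u\<rangle> \<ge> b\<close> satisfies
  \<open>\<langle>g\<^sub>i, y\<rangle> = t \<langle>g\<^sub>i, x\<rangle> + s \<langle>g\<^sub>i, u\<rangle> > s b - t \<tau>\<close> when \<open>t > 0\<close>, and \<open>\<langle>g\<^sub>i, y\<rangle> > 0\<close> when \<open>t \<le> 0\<close>.
  Consistency makes it negative, so \<open>t > 0\<close> and \<open>s < \<tau> / b\<close>; and \<open>\<parallel>x - y\<parallel>\<^sup>2 = 2 - 2 t \<le> 2 s\<^sup>2\<close>.
  For \<open>s = 0\<close> the only alternative to \<open>y = x\<close> is \<open>y = - x\<close>, which any window vector excludes.\<close>

lemma consistent_close:
  assumes x: "(\<Sum>k<d. (x k)\<^sup>2) = 1" and y: "(\<Sum>k<d. (y k)\<^sup>2) = 1" and b: "b > 0"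
    and W: "W \<noteq> {}" "\<And>i. i \<in> W \<Longrightarrow> - \<tau> < inner_prod d (g i) x \<and> inner_prod d (g i) x < 0"
    and hit: "\<And>u. (\<Sum>k<d. (u k)\<^sup>2) = 1 \<Longrightarrow> inner_prod d x u = 0 \<Longrightarrow> \<exists>i\<in>W. b \<le> inner_prod d (g i) u"
    and cons: "\<And>i. i \<in> W \<Longrightarrow> sgn (inner_prod d (g i) x) = sgn (inner_prod d (g i) y)"
  shows "norm2 d (\<lambda>k. x k - y k) \<le> sqrt 2 * (\<tau> / b)"
proof -
  have neg: "inner_prod d (g i) y < 0" if "i \<in> W" for i
    using cons[OF that] W(2)[OF that] by (auto simp: sgn_if split: if_splits)
  define t where "t = inner_prod d x y"
  have rest: "(\<Sum>k<d. (y k - t * x k)\<^sup>2) = 1 - t\<^sup>2"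
  proof -
    have "(\<Sum>k<d. (y k - t * x k)\<^sup>2) =
        (\<Sum>k<d. (y k)\<^sup>2) - 2 * t * inner_prod d x y + t\<^sup>2 * (\<Sum>k<d. (x k)\<^sup>2)"
      unfolding inner_prod_def
      by (simp add: sum_distrib_left sum.distrib sum_subtractf power2_eq_square algebra_simps)
    then show ?thesis unfolding x y t_def[symmetric] by (simp add: power2_eq_square)
  qed
  have dist: "norm2 d (\<lambda>k. x k - y k) = sqrt (2 - 2 * t)"
  proof -
    have "(\<Sum>k<d. (x k - y k)\<^sup>2) = (\<Sum>k<d. (x k)\<^sup>2) + (\<Sum>k<d. (y k)\<^sup>2) - 2 * inner_prod d x y"
      unfolding inner_prod_def
      by (simp add: sum_distrib_left sum.distrib sum_subtractf power2_eq_square algebra_simps)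
    then show ?thesis by (simp add: norm2_eq_sqrt x y t_def)
  qed
  have t2: "t\<^sup>2 \<le> 1"
    using rest sum_nonneg[of "{..<d}" "\<lambda>k. (y k - t * x k)\<^sup>2"] by simp
  then have t1: "\<bar>t\<bar> \<le> 1" by (simp add: abs_square_le_1)
  obtain i0 where i0: "i0 \<in> W" using W(1) by blast
  have \<tau>: "\<tau> > 0" using W(2)[OF i0] by linarith
  show ?thesis
  proof (cases "t\<^sup>2 = 1")
    case True
    then have "t = 1 \<or> t = -1" by (simp add: power2_eq_1_iff)
    then show ?thesis
    proof
      assume "t = 1"
      then show ?thesis using dist \<tau> b by simp
    next
      assume t: "t = -1"
      have "\<forall>k\<in>{..<d}. (y k - t * x k)\<^sup>2 = 0"
        using rest True by (intro sum_nonneg_eq_0_iff[THEN iffD1]) auto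
      then have "\<forall>k<d. y k = - x k" using t by (simp add: eq_neg_iff_add_eq_0)
      then have "inner_prod d (g i0) y = - inner_prod d (g i0) x"
        by (simp add: inner_prod_def sum_negf)
      then show ?thesis using neg[OF i0] W(2)[OF i0] by linarith
    qed
  next
    case False
    define s where "s = sqrt (1 - t\<^sup>2)"
    have s: "s > 0" "s\<^sup>2 = 1 - t\<^sup>2" using False t2 by (auto simp: s_def)
    define u where "u k = (y k - t * x k) / s" for k
    have "(\<Sum>k<d. (u k)\<^sup>2) = 1"
      using s False by (simp add: u_def power_divide sum_divide_distrib[symmetric] rest)
    moreover have "inner_prod d x u = 0"
    proof -
      have "inner_prod d x u = (inner_prod d x y - t * (\<Sum>k<d. (x k)\<^sup>2)) / s"
        unfolding inner_prod_def u_def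
        by (simp add: sum_distrib_left sum_subtractf sum_divide_distrib power2_eq_square algebra_simps diff_divide_distrib)
      then show ?thesis by (simp add: x t_def)
    qed
    ultimately obtain i where i: "i \<in> W" "b \<le> inner_prod d (g i) u" using hit by blast
    have yu: "inner_prod d (g i) y = t * inner_prod d (g i) x + s * inner_prod d (g i) u"
    proof -
      have "y k = t * x k + s * u k" for k using s by (simp add: u_def)
      then show ?thesis
        by (simp add: inner_prod_def sum_distrib_left sum.distrib algebra_simps)
    qed
    let ?a = "inner_prod d (g i) x"
    have a: "- \<tau> < ?a" "?a < 0" using W(2)[OF i(1)] by auto
    have sb: "s * b \<le> s * inner_prod d (g i) u" using s i(2) by simp
    then have less: "s * b < t * (- ?a)" using neg[OF i(1)] yu by simp
    moreover have "s * b > 0" using s b by simp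
    ultimately have "t * (- ?a) > 0" by linarith
    then have t0: "t > 0" using a by (auto simp: mult_less_0_iff)
    have "t * (- ?a) \<le> 1 * (- ?a)" using t1 a by (intro mult_right_mono) auto
    then have "s * b \<le> \<tau>" using less a by linarith
    then have sle: "s \<le> \<tau> / b" using b by (simp add: field_simps)
    have "1 - t \<le> (1 - t) * (1 + t)" using t0 t1 mult_left_mono[of 1 "1 + t" "1 - t"] by auto
    then have "2 - 2 * t \<le> 2 * s\<^sup>2" unfolding s(2) by (simp add: power2_eq_square algebra_simps)
    then have "sqrt (2 - 2 * t) \<le> sqrt (2 * s\<^sup>2)" by (rule real_sqrt_le_mono)
    also have "\<dots> = sqrt 2 * s" using s(1) by (simp only: real_sqrt_mult real_sqrt_abs abs_of_pos)
    also have "\<dots> \<le> sqrt 2 * (\<tau> / b)" using sle by (intro mult_left_mono) auto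
    finally show ?thesis unfolding dist .
  qed
qed

section \<open>The good event for the sample\<close>

lemma (in prob_space) measure_PiM_component:
  assumes "i \<in> I" "A \<in> sets M"
  shows "measure (\<Pi>\<^sub>M i\<in>I. M) {g \<in> space (\<Pi>\<^sub>M i\<in>I. M). g i \<in> A} = prob A"
proof -
  interpret P: product_prob_space "\<lambda>_. M" I by unfold_locales
  show ?thesis
    using P.emeasure_PiM_Collect_single[OF assms] by (simp add: measure_def)
qed

lemma gaussian_sample_coordinate_tail:
  fixes d M :: nat and r :: real
  assumes d: "d \<ge> 1" and r: "r \<ge> 0"
  defines "B \<equiv> {g \<in> space (gaussian_sample d M). \<exists>i\<in>{1..M}. \<exists>k<d. \<bar>g i k\<bar> > r}"
  shows "B \<in> sets (gaussian_sample d M)"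
    and "measure (gaussian_sample d M) B \<le> M * d * (sqrt 2 * exp (- (d * r\<^sup>2 / 4)))"
proof -
  interpret P: prob_space "gaussian_sample d M" using d by (rule prob_space_gaussian_sample)
  interpret G: prob_space "gaussian_vector d" using d by (rule prob_space_gaussian_vector)
  interpret N: prob_space "normal_law (1 / sqrt d)" using d by (intro prob_space_normal_law) simp
  define C where "C k = {z \<in> space (gaussian_vector d). z k \<in> {y :: real. \<bar>y\<bar> > r}}" for k
  define D where "D j = {g \<in> space (gaussian_sample d M). g (fst j) \<in> C (snd j)}" for j
  let ?J = "{1..M} \<times> {..<d}"
  have zk: "(\<lambda>z. z k) \<in> measurable (gaussian_vector d) (normal_law (1 / sqrt d))" if "k < d" for k
    unfolding gaussian_vector_eq using that by (intro measurable_component_singleton) simp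
  have C: "C k \<in> sets (gaussian_vector d)" if "k < d" for k
  proof -
    have "(\<lambda>z. z k) -` {y. \<bar>y\<bar> > r} \<inter> space (gaussian_vector d) \<in> sets (gaussian_vector d)"
      by (intro measurable_sets[OF zk[OF that]]) simp
    then show ?thesis by (simp add: C_def vimage_def Int_def conj_commute)
  qed
  have Dset: "D j \<in> sets (gaussian_sample d M)" if "j \<in> ?J" for j
  proof -
    have "(\<lambda>g. g (fst j)) -` C (snd j) \<inter> space (gaussian_sample d M) \<in> sets (gaussian_sample d M)"
      using that by (intro measurable_sets[OF measurable_sample_component C]) auto
    then show ?thesis by (simp add: D_def vimage_def Int_def conj_commute)
  qed
  have Dm: "measure (gaussian_sample d M) (D j) \<le> sqrt 2 * exp (- (d * r\<^sup>2 / 4))" if j: "j \<in> ?J" for j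
  proof -
    have "measure (gaussian_sample d M) (D j) = measure (gaussian_vector d) (C (snd j))"
      unfolding D_def gaussian_sample_def using j by (intro G.measure_PiM_component C) auto
    also have "\<dots> = measure (normal_law (1 / sqrt d)) {y. \<bar>y\<bar> > r}"
      unfolding C_def gaussian_vector_eq using j by (intro N.measure_PiM_component) auto
    also have "\<dots> \<le> sqrt 2 * exp (- (d * r\<^sup>2 / 4))"
      using normal_law_tail[of "1 / sqrt d" r] d r by (simp add: power_divide mult.commute)
    finally show ?thesis .
  qed
  have g: "g i \<in> space (gaussian_vector d)" if "g \<in> space (gaussian_sample d M)" "i \<in> {1..M}" for g i
    using that by (auto simp: gaussian_sample_def space_PiM)
  have B: "B = (\<Union>j\<in>?J. D j)"
    unfolding B_def D_def C_def using g by fastforce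
  show "B \<in> sets (gaussian_sample d M)"
    unfolding B using Dset by (intro sets.finite_UN) auto
  have "measure (gaussian_sample d M) B \<le> (\<Sum>j\<in>?J. measure (gaussian_sample d M) (D j))"
    unfolding B using Dset by (intro P.finite_measure_subadditive_finite) auto
  also have "\<dots> \<le> (\<Sum>j\<in>?J. sqrt 2 * exp (- (d * r\<^sup>2 / 4)))" by (intro sum_mono Dm)
  also have "\<dots> = M * d * (sqrt 2 * exp (- (d * r\<^sup>2 / 4)))" by (simp add: card_cartesian_product)
  finally show "measure (gaussian_sample d M) B \<le> M * d * (sqrt 2 * exp (- (d * r\<^sup>2 / 4)))" .
qed

text \<open>The standard normal density at \<open>3\<close>, the lower bound for the density on the intervals in use.\<close>

definition \<kappa> :: real where "\<kappa> = exp (- 9 / 2) / sqrt (2 * pi)"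

lemma \<kappa>_pos: "\<kappa> > 0" by (simp add: \<kappa>_def)

lemma gaussian_slab_prob:
  fixes x :: "nat \<Rightarrow> real" and h :: real
  assumes d: "d \<ge> 1" and x: "(\<Sum>k<d. (x k)\<^sup>2) = 1" and h: "0 \<le> h" "h \<le> 1"
  defines "A \<equiv> {z \<in> space (gaussian_vector d). inner_prod d z x \<in> {- (h / sqrt d)<..<0}}"
  shows "A \<in> sets (gaussian_vector d)" and "\<kappa> * h \<le> measure (gaussian_vector d) A"
    and "measure (gaussian_vector d) A \<le> h / 2"
proof -
  show "A \<in> sets (gaussian_vector d)" unfolding A_def by measurable
  have eq: "measure (gaussian_vector d) A = measure (normal_law (1 / sqrt d)) {- h / sqrt d<..<0 / sqrt d}"
    unfolding A_def using gaussian_vector_prob[OF d x, of "{- (h / sqrt d)<..<0}"] by simp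
  show "\<kappa> * h \<le> measure (gaussian_vector d) A" "measure (gaussian_vector d) A \<le> h / 2"
    unfolding eq using normal_law_interval_bounds[OF d, of "-h" 0] h by (simp_all add: \<kappa>_def)
qed

text \<open>Window membership and a large component along \<open>u\<close> are independent, hence the probability is
  still linear in the width \<open>h\<close>. The threshold \<open>2 / sqrt d\<close> leaves a margin \<open>1 / sqrt d\<close> for the
  discretisation of \<open>u\<close>.\<close>

lemma gaussian_slab_cap_prob:
  fixes x u :: "nat \<Rightarrow> real" and h :: real
  assumes d: "d \<ge> 1" and x: "(\<Sum>k<d. (x k)\<^sup>2) = 1" and u: "(\<Sum>k<d. (u k)\<^sup>2) = 1"
    and orth: "inner_prod d x u = 0" and h: "0 \<le> h" "h \<le> 1"
  defines "A \<equiv> {z \<in> space (gaussian_vector d). inner_prod d z x \<in> {- (h / sqrt d)<..<0} \<and>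
      inner_prod d z u \<in> {2 / sqrt d<..}}"
  shows "A \<in> sets (gaussian_vector d)" and "\<kappa>\<^sup>2 * h \<le> measure (gaussian_vector d) A"
proof -
  interpret N: prob_space "normal_law (1 / sqrt d)" using d by (intro prob_space_normal_law) simp
  show "A \<in> sets (gaussian_vector d)" unfolding A_def by measurable
  have "\<kappa> * (3 - 2) \<le> measure (normal_law (1 / sqrt d)) {2 / sqrt d<..<3 / sqrt d}"
    using normal_law_interval_bounds(1)[OF d, of 2 3] by (simp add: \<kappa>_def)
  also have "\<dots> \<le> measure (normal_law (1 / sqrt d)) {2 / sqrt d<..}"
    by (intro N.finite_measure_mono) auto
  finally have cap: "\<kappa> \<le> measure (normal_law (1 / sqrt d)) {2 / sqrt d<..}" by simp
  have "\<kappa> * h \<le> measure (normal_law (1 / sqrt d)) {- h / sqrt d<..<0 / sqrt d}"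
    using normal_law_interval_bounds(1)[OF d, of "-h" 0] h by (simp add: \<kappa>_def)
  then have "(\<kappa> * h) * \<kappa> \<le> measure (normal_law (1 / sqrt d)) {- h / sqrt d<..<0 / sqrt d} *
      measure (normal_law (1 / sqrt d)) {2 / sqrt d<..}"
    using cap \<kappa>_pos h by (intro mult_mono) auto
  also have "\<dots> = measure (gaussian_vector d) A"
    unfolding A_def by (subst gaussian_vector_orthonormal_prob[OF d x u orth]) auto
  finally show "\<kappa>\<^sup>2 * h \<le> measure (gaussian_vector d) A"
    by (simp add: power2_eq_square mult_ac)
qed

text \<open>The four failure terms come from the two tails of the window count, from a union bound over
  a net of directions \<open>u\<close>, and from the event that some coordinate of some \<open>g\<^sub>i\<close> exceeds \<open>r\<close>. For a
  fixed direction the \<open>M\<close> vectors fail independently; conditioning on the window is avoided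
  by treating "in the window and far along \<open>u\<close>" as one event for each vector. If all
  coordinates are at most \<open>r\<close>, replacing \<open>u\<close> by a net point changes \<open>\<langle>g\<^sub>i, u\<rangle>\<close> by at most
  \<open>d * (r * \<eta>) \<le> 1 / sqrt d\<close>.\<close>

lemma gaussian_sample_good_event:
  fixes d M :: nat and x :: "nat \<Rightarrow> real" and h \<tau> r \<eta> :: real
  assumes d: "d \<ge> 1" and x: "(\<Sum>k<d. (x k)\<^sup>2) = 1" and h: "0 \<le> h" "h \<le> 1" and \<tau>: "\<tau> = h / sqrt d"
    and r: "r \<ge> 0" and \<eta>: "0 < \<eta>" "\<eta> \<le> 1" "d * (r * \<eta>) \<le> 1 / sqrt d"
  obtains E where "E \<in> sets (gaussian_sample d M)"
    "measure (gaussian_sample d M) E \<ge> 1 - (exp (- (\<kappa> * h * M)) + exp (- (\<kappa> * h * M / 10))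
       + (5 / \<eta>) ^ d * exp (- (\<kappa>\<^sup>2 * h * M)) + M * d * (sqrt 2 * exp (- (d * r\<^sup>2 / 4))))"
    "\<forall>g\<in>E. \<kappa> * h * M / 2 \<le> card (window d M \<tau> x g)"
    "\<forall>g\<in>E. card (window d M \<tau> x g) \<le> 3 * h * M / 2"
    "\<forall>g\<in>E. \<forall>u. (\<Sum>k<d. (u k)\<^sup>2) = 1 \<longrightarrow> inner_prod d x u = 0 \<longrightarrow>
       (\<exists>i\<in>window d M \<tau> x g. 1 / sqrt d \<le> inner_prod d (g i) u)"
proof -
  let ?P = "gaussian_sample d M" and ?G = "gaussian_vector d"
  interpret P: prob_space ?P using d by (rule prob_space_gaussian_sample)
  interpret G: prob_space ?G using d by (rule prob_space_gaussian_vector)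
  have sp: "g i \<in> space ?G" if "g \<in> space ?P" "i \<in> {1..M}" for g i
    using that by (auto simp: gaussian_sample_def space_PiM)
  define A where "A = {z \<in> space ?G. inner_prod d z x \<in> {- (h / sqrt d)<..<0}}"
  note A = gaussian_slab_prob[OF d x h, folded A_def]
  have win: "window d M \<tau> x g = {i \<in> {1..M}. g i \<in> A}" if "g \<in> space ?P" for g
    using sp[OF that] by (auto simp: window_def A_def \<tau>)
  define m where "m = card {1..M} * measure ?G A"
  have "\<kappa> * h * M \<le> measure ?G A * M" "measure ?G A * M \<le> h / 2 * M"
    by (intro mult_right_mono A(2,3); simp)+
  then have m: "\<kappa> * h * M \<le> m" "m \<le> h * M / 2" by (auto simp: m_def mult_ac)
  define B1 where "B1 = {g \<in> space ?P. real (card {i \<in> {1..M}. g i \<in> A}) \<ge> 3 * m}"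
  define B2 where "B2 = {g \<in> space ?P. real (card {i \<in> {1..M}. g i \<in> A}) \<le> m / 2}"
  have [measurable]: "(\<lambda>g. card {i \<in> {1..M}. g i \<in> A}) \<in> measurable ?P (count_space UNIV)"
    unfolding gaussian_sample_def by (rule G.power_measurable_card[OF _ A(1)]) simp
  have B12: "B1 \<in> sets ?P" "B2 \<in> sets ?P" unfolding B1_def B2_def by measurable
  have "measure ?P B1 \<le> exp (- m)" "measure ?P B2 \<le> exp (- m / 10)"
    using G.power_count_tails[of "{1..M}" A] A(1)
    unfolding B1_def B2_def m_def gaussian_sample_def by auto
  moreover have "exp (- m) \<le> exp (- (\<kappa> * h * M))" "exp (- m / 10) \<le> exp (- (\<kappa> * h * M / 10))"
    using m(1) by auto
  ultimately have mB12: "measure ?P B1 \<le> exp (- (\<kappa> * h * M))" "measure ?P B2 \<le> exp (- (\<kappa> * h * M / 10))"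
    by linarith+
  define T where "T = {u. (\<Sum>k<d. (u k)\<^sup>2) = 1 \<and> inner_prod d x u = 0}"
  have Tb: "\<forall>u\<in>T. \<forall>k<d. \<bar>u k\<bar> \<le> 1"
  proof (intro ballI allI impI)
    fix u k assume that: "u \<in> T" "k < d"
    have "(u k)\<^sup>2 \<le> (\<Sum>k<d. (u k)\<^sup>2)" using that(2) by (intro member_le_sum) auto
    then show "\<bar>u k\<bar> \<le> 1" using that(1) by (simp add: T_def abs_square_le_1)
  qed
  obtain N where N: "N \<subseteq> T" "finite N" "real (card N) \<le> (5 / \<eta>) ^ d"
      "\<forall>u\<in>T. \<exists>v\<in>N. \<forall>k<d. \<bar>u k - v k\<bar> \<le> \<eta>"
    by (rule cube_net[of T d \<eta>, OF Tb \<eta>(1,2)])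
  define Au where "Au u = {z \<in> space ?G. inner_prod d z x \<in> {- (h / sqrt d)<..<0} \<and>
      inner_prod d z u \<in> {2 / sqrt d<..}}" for u
  have Au: "Au u \<in> sets ?G" "\<kappa>\<^sup>2 * h \<le> measure ?G (Au u)" if "u \<in> T" for u
    using gaussian_slab_cap_prob[OF d x _ _ h, of u, folded Au_def] that by (auto simp: T_def)
  define B3u where "B3u u = {g \<in> space ?P. \<forall>i\<in>{1..M}. g i \<notin> Au u}" for u
  have B3u: "B3u u \<in> sets ?P" "measure ?P (B3u u) \<le> exp (- (\<kappa>\<^sup>2 * h * M))" if u: "u \<in> T" for u
  proof -
    note [measurable] = Au(1)[OF u]
    show "B3u u \<in> sets ?P"
      unfolding B3u_def by measurable
    have "measure ?P (B3u u) = (1 - measure ?G (Au u)) ^ M"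
      using G.power_prob_all_avoid[of "{1..M}" "Au u"] Au(1)[OF u]
      by (simp add: B3u_def gaussian_sample_def)
    also have "\<dots> \<le> exp (- measure ?G (Au u)) ^ M"
    proof (intro power_mono)
      show "1 - measure ?G (Au u) \<le> exp (- measure ?G (Au u))"
        using exp_ge_add_one_self[of "- measure ?G (Au u)"] by simp
    qed simp
    also have "\<dots> = exp (- (measure ?G (Au u) * M))"
      by (simp add: exp_of_nat_mult[symmetric] mult.commute)
    also have "\<dots> \<le> exp (- (\<kappa>\<^sup>2 * h * M))"
      using Au(2)[OF u] by (simp add: mult_right_mono)
    finally show "measure ?P (B3u u) \<le> exp (- (\<kappa>\<^sup>2 * h * M))" .
  qed
  define B3 where "B3 = (\<Union>u\<in>N. B3u u)"
  have B3: "B3 \<in> sets ?P" unfolding B3_def using B3u(1) N(1,2) by (intro sets.finite_UN) auto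
  have "measure ?P B3 \<le> (\<Sum>u\<in>N. measure ?P (B3u u))"
    unfolding B3_def using B3u(1) N(1,2) by (intro P.finite_measure_subadditive_finite) auto
  also have "\<dots> \<le> (\<Sum>u\<in>N. exp (- (\<kappa>\<^sup>2 * h * M)))" using B3u(2) N(1) by (intro sum_mono) auto
  also have "\<dots> = card N * exp (- (\<kappa>\<^sup>2 * h * M))" by simp
  also have "\<dots> \<le> (5 / \<eta>) ^ d * exp (- (\<kappa>\<^sup>2 * h * M))" by (intro mult_right_mono N(3)) simp
  finally have mB3: "measure ?P B3 \<le> (5 / \<eta>) ^ d * exp (- (\<kappa>\<^sup>2 * h * M))" .
  define B4 where "B4 = {g \<in> space ?P. \<exists>i\<in>{1..M}. \<exists>k<d. \<bar>g i k\<bar> > r}"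
  note B4 = gaussian_sample_coordinate_tail[OF d r, of M, folded B4_def]
  define B where "B = B1 \<union> B2 \<union> B3 \<union> B4"
  have B: "B \<in> sets ?P" using B12 B3 B4(1) by (auto simp: B_def)
  have "measure ?P B \<le> measure ?P B1 + measure ?P B2 + measure ?P B3 + measure ?P B4"
    unfolding B_def
    by (intro order_trans[OF measure_Un_le] add_mono sets.Un B12 B3 B4(1) order_refl)
  then have mB: "measure ?P B \<le> exp (- (\<kappa> * h * M)) + exp (- (\<kappa> * h * M / 10))
       + (5 / \<eta>) ^ d * exp (- (\<kappa>\<^sup>2 * h * M)) + M * d * (sqrt 2 * exp (- (d * r\<^sup>2 / 4)))"
    using mB12 mB3 B4(2) by linarith
  show ?thesis
  proof (rule that[of "space ?P - B"])
    show "space ?P - B \<in> sets ?P" using B by simp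
    show "1 - (exp (- (\<kappa> * h * M)) + exp (- (\<kappa> * h * M / 10))
       + (5 / \<eta>) ^ d * exp (- (\<kappa>\<^sup>2 * h * M)) + M * d * (sqrt 2 * exp (- (d * r\<^sup>2 / 4)))) \<le> measure ?P (space ?P - B)"
      using mB P.prob_compl[OF B] by linarith
    have cards: "\<kappa> * h * M / 2 \<le> card (window d M \<tau> x g) \<and> card (window d M \<tau> x g) \<le> 3 * h * M / 2"
      if g: "g \<in> space ?P - B" for g
    proof -
      have gs: "g \<in> space ?P" using g by simp
      have "\<not> real (card (window d M \<tau> x g)) \<le> m / 2" "\<not> real (card (window d M \<tau> x g)) \<ge> 3 * m"
        using g win[OF gs] by (auto simp: B_def B1_def B2_def)
      then show ?thesis using m by linarith
    qed
    then show "\<forall>g\<in>space ?P - B. \<kappa> * h * M / 2 \<le> card (window d M \<tau> x g)"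
      "\<forall>g\<in>space ?P - B. card (window d M \<tau> x g) \<le> 3 * h * M / 2" by blast+
    show "\<forall>g\<in>space ?P - B. \<forall>u. (\<Sum>k<d. (u k)\<^sup>2) = 1 \<longrightarrow> inner_prod d x u = 0 \<longrightarrow>
       (\<exists>i\<in>window d M \<tau> x g. 1 / sqrt d \<le> inner_prod d (g i) u)"
    proof (intro ballI allI impI)
      fix g u assume g: "g \<in> space ?P - B" and "(\<Sum>k<d. (u k)\<^sup>2) = 1" "inner_prod d x u = 0"
      then have gs: "g \<in> space ?P" by simp
      have "u \<in> T" using \<open>(\<Sum>k<d. (u k)\<^sup>2) = 1\<close> \<open>inner_prod d x u = 0\<close> by (simp add: T_def)
      then obtain v where v: "v \<in> N" "\<forall>k<d. \<bar>u k - v k\<bar> \<le> \<eta>" using N(4) by blast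
      have "g \<notin> B3u v" using g v by (auto simp: B_def B3_def)
      then obtain i where i: "i \<in> {1..M}" "g i \<in> Au v" using gs by (auto simp: B3u_def)
      have iw: "i \<in> window d M \<tau> x g" using i by (auto simp: window_def Au_def \<tau>)
      have gv: "2 / sqrt d < inner_prod d (g i) v" using i by (auto simp: Au_def)
      have gr: "\<bar>g i k\<bar> \<le> r" if "k < d" for k
        using g gs i(1) that by (force simp: B_def B4_def)
      have "inner_prod d (g i) v - inner_prod d (g i) u = (\<Sum>k<d. g i k * (v k - u k))"
        by (simp add: inner_prod_def sum_subtractf algebra_simps)
      also have "\<dots> \<le> (\<Sum>k<d. r * \<eta>)"
      proof (intro sum_mono)
        fix k assume k: "k \<in> {..<d}"
        have "g i k * (v k - u k) \<le> \<bar>g i k\<bar> * \<bar>u k - v k\<bar>"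
          by (metis abs_ge_self abs_minus_commute abs_mult)
        also have "\<dots> \<le> r * \<eta>" using gr v k r by (intro mult_mono) auto
        finally show "g i k * (v k - u k) \<le> r * \<eta>" .
      qed
      also have "\<dots> \<le> 1 / sqrt d" using \<eta>(3) by simp
      finally have "1 / sqrt d \<le> inner_prod d (g i) u" using gv by simp
      with iw show "\<exists>i\<in>window d M \<tau> x g. 1 / sqrt d \<le> inner_prod d (g i) u" by blast
    qed
  qed
qed

section \<open>Choice of constants\<close>

text \<open>The window constant. The net costs \<open>exp (10 * B)\<close> with \<open>B = d log d log M\<close>, and a fixed direction
  fails with probability at most \<open>exp (- \<kappa>\<^sup>2 * \<Lambda> * B)\<close>; \<open>\<kappa>\<^sup>2 * \<Lambda> = 11\<close> leaves \<open>exp (- B)\<close>.\<close>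

definition \<Lambda> :: real where "\<Lambda> = 11 / \<kappa>\<^sup>2"

lemma \<kappa>_le_1: "\<kappa> \<le> 1"
proof -
  have "1 \<le> sqrt (2 * pi)" using pi_gt3 by simp
  moreover have "exp (- 9 / 2 :: real) \<le> 1" by simp
  ultimately have "exp (- 9 / 2 :: real) \<le> 1 * sqrt (2 * pi)" by linarith
  then show ?thesis unfolding \<kappa>_def by (subst pos_divide_le_eq) simp_all
qed

lemma \<Lambda>_bounds: "\<Lambda> \<ge> 11" "\<kappa> * \<Lambda> \<ge> 11" "\<kappa>\<^sup>2 * \<Lambda> = 11"
proof -
  show eq: "\<kappa>\<^sup>2 * \<Lambda> = 11" using \<kappa>_pos by (simp add: \<Lambda>_def)
  have L: "\<Lambda> > 0" using \<kappa>_pos by (simp add: \<Lambda>_def)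
  have "\<kappa> * (\<kappa> * \<Lambda>) \<le> 1 * (\<kappa> * \<Lambda>)" using \<kappa>_le_1 \<kappa>_pos L by (intro mult_right_mono) auto
  then show k: "\<kappa> * \<Lambda> \<ge> 11" using eq by (simp add: power2_eq_square mult.assoc)
  have "\<kappa> * \<Lambda> \<le> 1 * \<Lambda>" using \<kappa>_le_1 L by (intro mult_right_mono) auto
  then show "\<Lambda> \<ge> 11" using k by simp
qed

lemma sample_size_bounds:
  fixes d M :: nat
  assumes d: "d \<ge> 2" and M: "M \<ge> 2" and ratio: "real M / ln M \<ge> C * real d * ln d" and C: "C \<ge> 11"
  shows "ln d \<ge> 2 / 3" "d * ln d \<ge> 4 / 3" "ln M \<ge> 1" "C * (d * ln d * ln M) \<le> M"
proof -
  have "ln 2 \<le> ln (real d)" using d by (subst ln_le_cancel_iff) auto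
  then show ld: "ln d \<ge> 2 / 3" using ln2_ge_two_thirds by linarith
  have "2 * (2 / 3) \<le> d * ln d" using d ld by (intro mult_mono) auto
  then show dld: "d * ln d \<ge> 4 / 3" by simp
  have lM: "ln M > 0" using M by simp
  \<comment> \<open>\<open>M = 2\<close> is the only case in which \<open>ln M < 1\<close>\<close>
  have "M \<noteq> 2"
  proof
    assume M2: "M = 2"
    have "11 * (4 / 3) \<le> C * (d * ln d)" using C dld by (intro mult_mono) auto
    then have "11 * (4 / 3) * ln 2 \<le> C * (d * ln d) * ln 2" by (intro mult_right_mono) auto
    moreover have "C * (d * ln d) * ln 2 \<le> 2" using ratio M2 by (simp add: field_simps)
    ultimately show False using ln2_ge_two_thirds by linarith
  qed
  then have "exp 1 \<le> real M" using M exp_le by linarith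
  then show "ln M \<ge> 1" using M by (subst ln_ge_iff) auto
  show "C * (d * ln d * ln M) \<le> M" using ratio lM by (simp add: field_simps)
qed

text \<open>Here \<open>hM\<close> is \<open>h * M = \<Lambda> * B\<close>, and the grid width and coordinate bound are
  \<open>1 / (4 * d\<^sup>2 * log M)\<close> and \<open>4 * log M\<close>. The coordinate bound contributes \<open>exp (- d log M)\<close> since
  \<open>M * d * sqrt 2 \<le> M ^ 3\<close> is absorbed by the tail \<open>exp (- 4 * d * (log M)\<^sup>2)\<close>; each of the other
  terms is at most \<open>exp (- d log d)\<close>.\<close>

lemma failure_bound:
  fixes d M :: nat and B hM :: real
  defines "B \<equiv> d * ln d * ln M"
  assumes d: "d \<ge> 2" "ln d \<ge> 2 / 3" and lM: "ln M \<ge> 1" and dM: "d \<le> M"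
    and hM: "\<kappa> * hM \<ge> 11 * B" "\<kappa>\<^sup>2 * hM = 11 * B"
  shows "exp (- (\<kappa> * hM)) + exp (- (\<kappa> * hM / 10))
       + (5 / (1 / (4 * (real d)\<^sup>2 * ln M))) ^ d * exp (- (\<kappa>\<^sup>2 * hM)) + M * d * (sqrt 2 * exp (- (d * (4 * ln M)\<^sup>2 / 4)))
     \<le> 3 * exp (- (d * ln d)) + exp (- (d * ln M))"
proof -
  have M: "real M > 0" using dM d by simp
  have D: "d * ln d \<ge> 0" using d by simp
  have B: "d * ln d \<le> B" unfolding B_def using D lM mult_left_mono[OF lM D] by simp
  have e1: "exp (- (\<kappa> * hM)) \<le> exp (- (d * ln d))" using hM(1) B D by simp
  have e2: "exp (- (\<kappa> * hM / 10)) \<le> exp (- (d * ln d))" using hM(1) B D by simp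
  have e3: "(5 / (1 / (4 * (real d)\<^sup>2 * ln M))) ^ d * exp (- (\<kappa>\<^sup>2 * hM)) \<le> exp (- (d * ln d))"
  proof -
    have "(2::real) ^ 5 \<le> real d ^ 5" using d by (intro power_mono) auto
    \<comment> \<open>powers of \<open>d\<close> absorb the absolute constant, as \<open>d \<ge> 2\<close>\<close>
    then have "20 \<le> real d ^ 5" by simp
    moreover have "(real d)\<^sup>2 * ln M \<le> (real d)\<^sup>2 * real M"
      using M ln_bound[of "real M"] by (intro mult_left_mono) auto
    ultimately have "20 * ((real d)\<^sup>2 * ln M) \<le> real d ^ 5 * ((real d)\<^sup>2 * M)"
      by (rule mult_mono) (use lM in simp_all)
    also have "\<dots> = real d ^ 7 * M" by (simp add: power_add[symmetric] mult.assoc[symmetric])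
    also have "\<dots> = exp (7 * ln d + ln M)"
      using d M by (simp add: exp_add exp_of_nat_mult[of 7, simplified])
    also have "\<dots> \<le> exp (10 * (ln d * ln M))"
    proof -
      have "ln d * 1 \<le> ln d * ln M" using d lM by (intro mult_left_mono) auto
      moreover have "2 / 3 * ln M \<le> ln d * ln M" using d lM by (intro mult_right_mono) auto
      ultimately have "7 * ln d + ln M \<le> 10 * (ln d * ln M)" using lM by linarith
      then show ?thesis by simp
    qed
    finally have "20 * ((real d)\<^sup>2 * ln M) \<le> exp (10 * (ln d * ln M))" .
    then have "(5 / (1 / (4 * (real d)\<^sup>2 * ln M))) ^ d \<le> exp (10 * (ln d * ln M)) ^ d"
      using lM by (intro power_mono) (auto simp: mult.assoc)
    also have "\<dots> = exp (10 * B)" by (simp add: exp_of_nat_mult[symmetric] B_def mult_ac)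
    finally have "(5 / (1 / (4 * (real d)\<^sup>2 * ln M))) ^ d * exp (- (\<kappa>\<^sup>2 * hM)) \<le> exp (10 * B) * exp (- (11 * B))"
      unfolding hM(2) by (intro mult_right_mono) auto
    also have "\<dots> = exp (- B)" by (simp add: exp_add[symmetric])
    finally show ?thesis using B by (meson exp_le_cancel_iff neg_le_iff_le order_trans)
  qed
  have e4: "M * d * (sqrt 2 * exp (- (d * (4 * ln M)\<^sup>2 / 4))) \<le> exp (- (d * ln M))"
  proof -
    have "sqrt 2 \<le> 2" by (rule real_le_lsqrt) auto
    then have s: "sqrt 2 \<le> M" using dM d by linarith
    have "real M * d * sqrt 2 \<le> real M * M * M" using dM s by (intro mult_mono) auto
    also have "\<dots> = exp (3 * ln M)" using M by (simp add: exp_of_nat_mult[of 3, simplified] power3_eq_cube)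
    finally have m: "real M * d * sqrt 2 \<le> exp (3 * ln M)" .
    have "M * d * (sqrt 2 * exp (- (d * (4 * ln M)\<^sup>2 / 4))) = real M * d * sqrt 2 * exp (- (4 * d * (ln M * ln M)))"
      by (simp add: power2_eq_square mult_ac)
    also have "\<dots> \<le> exp (3 * ln M) * exp (- (4 * d * (ln M * ln M)))" by (intro mult_right_mono m) simp
    also have "\<dots> = exp (3 * ln M - 4 * d * (ln M * ln M))" by (simp add: exp_add[symmetric])
    also have "\<dots> \<le> exp (- (d * ln M))"
    proof -
      have "4 * d * (ln M * 1) \<le> 4 * d * (ln M * ln M)" using lM by (intro mult_left_mono) auto
      moreover have "1 * ln M \<le> d * ln M" using d lM by (intro mult_right_mono) auto
      ultimately have "3 * ln M - 4 * d * (ln M * ln M) \<le> - (d * ln M)" by linarith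
      then show ?thesis by simp
    qed
    finally show ?thesis .
  qed
  show ?thesis using e1 e2 e3 e4 by linarith
qed

section \<open>Recovery for fixed and random selections\<close>

lemma fixed_selection_bound:
  fixes d M :: nat and L B \<tau> :: real
  defines "L \<equiv> real d * ln (real d)" and "B \<equiv> real d * ln (real d) * ln (real M)"
  assumes d: "d \<ge> 2" and M: "M \<ge> 2" and ratio: "real M / ln M \<ge> \<Lambda> * real d * ln d"
    and x: "x \<in> unit_sphere d" and V: "V \<subseteq> {1..M}" "card V = nat \<lceil>L\<rceil>"
  defines "\<tau> \<equiv> \<Lambda> * (sqrt d * ln d * ln M / M)"
  shows "1 - 3 * exp (- L) - exp (- (d * ln M)) \<le> measure (gaussian_sample d M)
    {g \<in> space (gaussian_sample d M).
      \<kappa> * \<Lambda> / 2 * B \<le> real (card (window d M \<tau> x g \<union> V)) \<and>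
      real (card (window d M \<tau> x g \<union> V)) \<le> (2 * \<Lambda> + 2) * B \<and>
      (\<forall>y\<in>unit_sphere d. (\<forall>i\<in>window d M \<tau> x g \<union> V.
          sgn (inner_prod d (g i) x) = sgn (inner_prod d (g i) y)) \<longrightarrow>
        norm2 d (\<lambda>k. x k - y k) \<le> 2 * \<Lambda> * B / sqrt (M\<^sup>2 + B\<^sup>2))}"
    (is "_ \<le> measure ?P ?E")
proof -
  note Lb = \<Lambda>_bounds
  note sb = sample_size_bounds[OF d M ratio Lb(1)]
  have d1: "d \<ge> 1" using d by simp
  interpret P: prob_space ?P using d1 by (rule prob_space_gaussian_sample)
  have LB: "L \<le> B" using mult_left_mono[OF sb(3), of L] sb(2) by (simp add: L_def B_def)
  have B1: "B \<ge> 4 / 3" using LB sb(2) by (simp add: L_def)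
  have LBM: "\<Lambda> * B \<le> M" using sb(4) by (simp add: B_def)
  have "11 * B \<le> \<Lambda> * B" using Lb(1) B1 by (intro mult_right_mono) auto
  then have BM: "11 * B \<le> M" using LBM by linarith
  have Mpos: "real M > 0" using M by simp
  define h where "h = \<Lambda> * B / M"
  have hM: "h * M = \<Lambda> * B" using Mpos by (simp add: h_def)
  have h: "0 < h" "h \<le> 1" using LBM Mpos B1 Lb(1) by (auto simp: h_def)
  have sd: "sqrt (real d) * sqrt (real d) = d" by simp
  have \<tau>: "\<tau> = h / sqrt d"
  proof -
    have "\<tau> * sqrt d = \<Lambda> * ((sqrt (real d) * sqrt (real d)) * ln d * ln M / M)"
      by (simp add: \<tau>_def mult_ac del: real_sqrt_mult_self)
    also have "\<dots> = h" unfolding sd by (simp add: h_def B_def)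
    finally show ?thesis using d by (simp add: field_simps)
  qed
  have dM: "real d \<le> M"
  proof -
    have "2 / 3 * 1 \<le> ln d * ln M" using sb by (intro mult_mono) auto
    then have "real d * (2 / 3) \<le> real d * (ln d * ln M)" by (intro mult_left_mono) auto
    then have "real d * (2 / 3) \<le> B" by (simp add: B_def mult.assoc)
    then show ?thesis using BM by linarith
  qed
  define \<eta> where "\<eta> = 1 / (4 * (real d)\<^sup>2 * ln M)"
  define r where "r = 4 * ln (real M)"
  have r: "r \<ge> 0" using sb by (simp add: r_def)
  have \<eta>: "0 < \<eta>" "\<eta> \<le> 1"
  proof -
    have "1 \<le> (real d)\<^sup>2" using d by (intro one_le_power) simp
    then have "1 \<le> 4 * (real d)\<^sup>2" by linarith
    then have "1 * 1 \<le> (4 * (real d)\<^sup>2) * ln M" using sb(3) by (intro mult_mono) auto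
    then have ge: "1 \<le> 4 * (real d)\<^sup>2 * ln M" by simp
    then have gt: "0 < 4 * (real d)\<^sup>2 * ln M" by linarith
    show "0 < \<eta>" unfolding \<eta>_def using gt by (rule divide_pos_pos[OF zero_less_one])
    show "\<eta> \<le> 1" unfolding \<eta>_def using ge gt by (simp only: divide_le_eq_1_pos)
  qed
  have \<eta>r: "d * (r * \<eta>) \<le> 1 / sqrt d"
  proof -
    have "d * (r * \<eta>) = 1 / d" using d sb(3) by (simp add: r_def \<eta>_def power2_eq_square)
    also have "\<dots> \<le> 1 / sqrt d"
      using d by (intro divide_left_mono real_le_lsqrt) (auto simp: power2_eq_square)
    finally show ?thesis .
  qed
  have xs: "(\<Sum>k<d. (x k)\<^sup>2) = 1" using x by (simp add: unit_sphere_def norm2_eq_sqrt)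
  obtain E where E: "E \<in> sets ?P"
    "measure ?P E \<ge> 1 - (exp (- (\<kappa> * h * M)) + exp (- (\<kappa> * h * M / 10))
       + (5 / \<eta>) ^ d * exp (- (\<kappa>\<^sup>2 * h * M)) + M * d * (sqrt 2 * exp (- (d * r\<^sup>2 / 4))))"
    "\<forall>g\<in>E. \<kappa> * h * M / 2 \<le> card (window d M \<tau> x g)"
    "\<forall>g\<in>E. card (window d M \<tau> x g) \<le> 3 * h * M / 2"
    "\<forall>g\<in>E. \<forall>u. (\<Sum>k<d. (u k)\<^sup>2) = 1 \<longrightarrow> inner_prod d x u = 0 \<longrightarrow>
       (\<exists>i\<in>window d M \<tau> x g. 1 / sqrt d \<le> inner_prod d (g i) u)"
    by (rule gaussian_sample_good_event[OF d1 xs less_imp_le[OF h(1)] h(2) \<tau> r \<eta> \<eta>r, of M])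
  have kh: "\<kappa> * (h * M) \<ge> 11 * B" "\<kappa>\<^sup>2 * (h * M) = 11 * B"
    unfolding hM using Lb mult_right_mono[OF Lb(2), of B] B1 by (simp_all add: mult.assoc[symmetric])
  have "d \<le> M" using dM by simp
  then have fail: "exp (- (\<kappa> * h * M)) + exp (- (\<kappa> * h * M / 10))
       + (5 / \<eta>) ^ d * exp (- (\<kappa>\<^sup>2 * h * M)) + M * d * (sqrt 2 * exp (- (d * r\<^sup>2 / 4)))
     \<le> 3 * exp (- L) + exp (- (d * ln M))"
    using failure_bound[of d M "h * M", OF d sb(1,3) _ kh[unfolded B_def]]
    unfolding \<eta>_def r_def L_def mult.assoc[of \<kappa> h] mult.assoc[of "\<kappa>\<^sup>2" h] by blast
  have "1 - 3 * exp (- L) - exp (- (d * ln M)) \<le> measure ?P E"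
    using E(2) fail by linarith
  also have "\<dots> \<le> measure ?P ?E"
  proof (rule P.finite_measure_mono[OF subsetI measurable_event[OF V(1)]])
    fix g assume g: "g \<in> E"
    let ?W = "window d M \<tau> x g"
    have fin: "finite ?W" "finite V" by (rule finite_subset[OF window_subset], simp) (rule finite_subset[OF V(1)], simp)
    have lo: "\<kappa> * \<Lambda> / 2 * B \<le> card ?W" using bspec[OF E(3) g] hM by (simp add: mult.assoc)
    also have "\<dots> \<le> real (card (?W \<union> V))" using fin by (simp add: card_mono)
    finally have c1: "\<kappa> * \<Lambda> / 2 * B \<le> real (card (?W \<union> V))" .
    have cV: "real (card V) \<le> 2 * B"
    proof -
      have "real (card V) \<le> L + 1" unfolding V(2) using sb(2) by (simp add: L_def)
      then show ?thesis using LB B1 by linarith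
    qed
    have "real (card (?W \<union> V)) \<le> real (card ?W) + real (card V)"
      using card_Un_le[of ?W V] by linarith
    also have "\<dots> \<le> 3 / 2 * (\<Lambda> * B) + 2 * B" using bspec[OF E(4) g] cV hM by (simp add: mult.assoc)
    also have "\<dots> \<le> (2 * \<Lambda> + 2) * B"
    proof -
      have "0 \<le> \<Lambda> * B" using Lb(1) B1 by simp
      then show ?thesis by (simp add: algebra_simps)
    qed
    finally have c2: "real (card (?W \<union> V)) \<le> (2 * \<Lambda> + 2) * B" .
    have "\<kappa> * \<Lambda> / 2 * B > 0" using \<kappa>_pos Lb(1) B1 by simp
    then have ne: "?W \<noteq> {}" using lo by auto
    have "norm2 d (\<lambda>k. x k - y k) \<le> 2 * \<Lambda> * B / sqrt (M\<^sup>2 + B\<^sup>2)"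
      if y: "y \<in> unit_sphere d"
        and c: "\<forall>i\<in>?W \<union> V. sgn (inner_prod d (g i) x) = sgn (inner_prod d (g i) y)" for y
    proof -
      have ys: "(\<Sum>k<d. (y k)\<^sup>2) = 1" using y by (simp add: unit_sphere_def norm2_eq_sqrt)
      have "norm2 d (\<lambda>k. x k - y k) \<le> sqrt 2 * (\<tau> / (1 / sqrt d))"
      proof (rule consistent_close[OF xs ys _ ne])
        show "\<And>u. (\<Sum>k<d. (u k)\<^sup>2) = 1 \<Longrightarrow> inner_prod d x u = 0 \<Longrightarrow> \<exists>i\<in>?W. 1 / sqrt d \<le> inner_prod d (g i) u"
          using bspec[OF E(5) g] by blast
        show "0 < 1 / sqrt d" using d by simp
        show "- \<tau> < inner_prod d (g i) x \<and> inner_prod d (g i) x < 0" if "i \<in> ?W" for i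
          using that by (simp add: window_def)
        show "sgn (inner_prod d (g i) x) = sgn (inner_prod d (g i) y)" if "i \<in> ?W" for i
          using c that by blast
      qed
      also have "\<dots> = sqrt 2 * (\<Lambda> * B) / M" using \<tau> d by (simp add: h_def)
      also have "\<dots> = 2 * \<Lambda> * B / (sqrt 2 * M)"
      proof -
        have "sqrt 2 * (\<Lambda> * B) / M = (sqrt 2 * (sqrt 2 * (\<Lambda> * B))) / (sqrt 2 * M)"
          by (rule nonzero_mult_divide_mult_cancel_left[symmetric]) simp
        also have "sqrt 2 * (sqrt 2 * (\<Lambda> * B)) = 2 * \<Lambda> * B" by (simp flip: mult.assoc)
        finally show ?thesis .
      qed
      also have "\<dots> \<le> 2 * \<Lambda> * B / sqrt (M\<^sup>2 + B\<^sup>2)"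
      proof (rule divide_left_mono)
        have "B\<^sup>2 \<le> (real M)\<^sup>2" using BM B1 by (intro power_mono) auto
        then have "sqrt (M\<^sup>2 + B\<^sup>2) \<le> sqrt (2 * (real M)\<^sup>2)" by (intro real_sqrt_le_mono) simp
        then show "sqrt (M\<^sup>2 + B\<^sup>2) \<le> sqrt 2 * M" by (simp add: real_sqrt_mult)
        show "0 \<le> 2 * \<Lambda> * B" using Lb(1) B1 by simp
        have "0 < (real M)\<^sup>2 + B\<^sup>2" using Mpos by (simp add: add_pos_nonneg)
        then show "0 < sqrt 2 * M * sqrt (M\<^sup>2 + B\<^sup>2)" using Mpos by simp
      qed
      finally show ?thesis .
    qed
    with c1 c2 show "g \<in> ?E" using sets.sets_into_space[OF E(1)] g by blast
  qed
  finally show ?thesis .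
qed

text \<open>A bound that is uniform in the selected set survives averaging over the selection.\<close>

lemma pair_prob_ge:
  assumes "prob_space P" "prob_space Q" and Q: "finite F" "sets Q = Pow F"
    and meas: "\<And>V. V \<in> F \<Longrightarrow> {g \<in> space P. \<Phi> g V} \<in> sets P"
    and ge: "\<And>V. V \<in> F \<Longrightarrow> b \<le> measure P {g \<in> space P. \<Phi> g V}"
  shows "b \<le> measure (P \<Otimes>\<^sub>M Q) {(g, V) \<in> space (P \<Otimes>\<^sub>M Q). \<Phi> g V}"
proof -
  interpret P: prob_space P by fact
  interpret Q: prob_space Q by fact
  interpret PQ: pair_prob_space P Q by unfold_locales
  have sp: "space Q = F" using Q(2) by (metis Pow_top sets.sets_into_space sets.top PowD subset_antisym)
  let ?A = "{(g, V) \<in> space (P \<Otimes>\<^sub>M Q). \<Phi> g V}"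
  have "?A = (\<Union>V\<in>F. {g \<in> space P. \<Phi> g V} \<times> {V})"
    using sp by (auto simp: space_pair_measure)
  also have "\<dots> \<in> sets (P \<Otimes>\<^sub>M Q)"
    using Q meas by (intro sets.finite_UN pair_measureI) auto
  finally have A: "?A \<in> sets (P \<Otimes>\<^sub>M Q)" .
  have "ennreal b = (\<integral>\<^sup>+V. ennreal b \<partial>Q)" by (simp add: Q.emeasure_space_1)
  also have "\<dots> \<le> (\<integral>\<^sup>+V. emeasure P ((\<lambda>g. (g, V)) -` ?A) \<partial>Q)"
  proof (intro nn_integral_mono)
    fix V assume V: "V \<in> space Q"
    then have "(\<lambda>g. (g, V)) -` ?A = {g \<in> space P. \<Phi> g V}" by (auto simp: space_pair_measure)
    then show "ennreal b \<le> emeasure P ((\<lambda>g. (g, V)) -` ?A)"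
      using ge V sp by (simp add: P.emeasure_eq_measure ennreal_leI)
  qed
  also have "\<dots> = emeasure (P \<Otimes>\<^sub>M Q) ?A" using A by (rule PQ.emeasure_pair_measure_alt2[symmetric])
  finally show ?thesis by (simp add: PQ.emeasure_eq_measure)
qed

definition recovers :: "nat \<Rightarrow> nat \<Rightarrow> (nat \<Rightarrow> real) \<Rightarrow> (nat \<Rightarrow> nat \<Rightarrow> real) \<Rightarrow> nat set \<Rightarrow> bool" where
  "recovers d M x g V \<longleftrightarrow>
     (let S = window d M (\<Lambda> * (sqrt (real d) * ln (real d) * ln (real M) / real M)) x g \<union> V in
       \<kappa> * \<Lambda> / 2 * real d * ln (real d) * ln (real M) \<le> real (card S) \<and>
       real (card S) \<le> (2 * \<Lambda> + 2) * real d * ln (real d) * ln (real M) \<and>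
       (\<forall>y\<in>unit_sphere d. (\<forall>i\<in>S. sgn (inner_prod d (g i) x) = sgn (inner_prod d (g i) y)) \<longrightarrow>
         norm2 d (\<lambda>k. x k - y k) \<le> 2 * \<Lambda> * real d * ln (real d) * ln (real M) /
           sqrt ((real M)\<^sup>2 + (real d)\<^sup>2 * (ln (real d))\<^sup>2 * (ln (real M))\<^sup>2)))"

lemma measurable_recovers:
  assumes "V \<subseteq> {1..M}"
  shows "{g \<in> space (gaussian_sample d M). recovers d M x g V} \<in> sets (gaussian_sample d M)"
  unfolding recovers_def Let_def by (rule measurable_event[OF assms])

lemma recovers_prob:
  assumes "d \<ge> 2" "M \<ge> 2" "real M / ln (real M) \<ge> \<Lambda> * real d * ln (real d)" "x \<in> unit_sphere d"
    and "V \<subseteq> {1..M}" "card V = nat \<lceil>real d * ln (real d)\<rceil>"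
  shows "1 - 3 * exp (- (real d * ln (real d))) - exp (- (real d * ln (real M)))
    \<le> measure (gaussian_sample d M) {g \<in> space (gaussian_sample d M). recovers d M x g V}"
  using fixed_selection_bound[OF assms]
  unfolding recovers_def Let_def by (simp add: power_mult_distrib mult.assoc)

lemma selection_size_le:
  fixes d M :: nat
  assumes d: "d \<ge> 1" and M: "M \<ge> 2" and ratio: "real M / ln (real M) \<ge> \<Lambda> * real d * ln (real d)"
  shows "nat \<lceil>real d * ln (real d)\<rceil> \<le> M"
proof (cases "d = 1")
  case False
  then have d2: "d \<ge> 2" using d by simp
  note sb = sample_size_bounds[OF d2 M ratio \<Lambda>_bounds(1)]
  have "real d * ln d * 1 \<le> real d * ln d * ln M" using sb by (intro mult_left_mono) auto
  moreover have "1 * (real d * ln d * ln M) \<le> \<Lambda> * (real d * ln d * ln M)"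
    using \<Lambda>_bounds(1) sb by (intro mult_right_mono) auto
  ultimately have "real d * ln d \<le> M" using sb(4) by linarith
  then show ?thesis by (simp only: nat_le_iff ceiling_le_iff of_int_of_nat_eq)
qed simp

lemma random_selection_recovers_prob:
  fixes d M :: nat
  assumes d: "d \<ge> 1" and M: "M \<ge> 2" and ratio: "real M / ln (real M) \<ge> \<Lambda> * real d * ln (real d)"
    and x: "x \<in> unit_sphere d" and Q: "selection_law M (nat \<lceil>real d * ln (real d)\<rceil>) Q"
  shows "1 - 3 * exp (- (real d * ln (real d))) - exp (- (real d * ln (real M)))
    \<le> measure (gaussian_sample d M \<Otimes>\<^sub>M Q)
        {(g, V) \<in> space (gaussian_sample d M \<Otimes>\<^sub>M Q). recovers d M x g V}"
proof (cases "d = 1")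
  case True
  \<comment> \<open>\<open>ln 1 = 0\<close>, so the claimed lower bound is negative\<close>
  have "1 - 3 * exp (- (real d * ln (real d))) - exp (- (real d * ln (real M))) \<le> 0"
  proof -
    have "exp (- (real d * ln (real d))) = 1" using True by simp
    moreover have "exp (- (real d * ln (real M))) \<ge> 0" by (rule exp_ge_zero)
    ultimately show ?thesis by linarith
  qed
  then show ?thesis by (rule order_trans[OF _ measure_nonneg])
next
  case False
  then have d2: "d \<ge> 2" using d by simp
  let ?F = "{V. V \<subseteq> {1..M} \<and> card V = nat \<lceil>real d * ln (real d)\<rceil>}"
  show ?thesis
  proof (rule pair_prob_ge[where F = ?F])
    show "prob_space (gaussian_sample d M)" using d by (rule prob_space_gaussian_sample)
    show "prob_space Q" "sets Q = Pow ?F" using Q by (auto simp: selection_law_def)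
    show "finite ?F" by (rule finite_subset[of _ "Pow {1..M}"]) auto
  next
    fix V assume V: "V \<in> ?F"
    then show "{g \<in> space (gaussian_sample d M). recovers d M x g V} \<in> sets (gaussian_sample d M)"
      by (intro measurable_recovers) blast
    show "1 - 3 * exp (- (real d * ln (real d))) - exp (- (real d * ln (real M)))
      \<le> measure (gaussian_sample d M) {g \<in> space (gaussian_sample d M). recovers d M x g V}"
      using V by (intro recovers_prob[OF d2 M ratio x]) blast+
  qed
qed

theorem mainTheorem1:
  "\<exists>C0 C1 C2 C3 C4 C5 c c' :: real.
     C0 > 0 \<and> C1 > 0 \<and> C2 > 0 \<and> C3 > 0 \<and> C4 > 0 \<and> C5 > 0 \<and> c > 0 \<and> c' > 0 \<and>
     (\<forall>d M :: nat.
        d \<ge> 1 \<and> M \<ge> 2 \<and> real M / ln (real M) \<ge> C0 * real d * ln (real d) \<longrightarrow>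
        nat \<lceil>C1 * real d * ln (real d)\<rceil> \<le> M \<and>
        (\<forall>x \<in> unit_sphere d. \<forall>Q.
           selection_law M (nat \<lceil>C1 * real d * ln (real d)\<rceil>) Q \<longrightarrow>
           (let \<tau> = C2 * (sqrt (real d) * ln (real d) * ln (real M) / real M);
                S = (\<lambda>g V. window d M \<tau> x g \<union> V);
                P = gaussian_sample d M \<Otimes>\<^sub>M Q
            in measure P {(g, V) \<in> space P.
                 C3 * real d * ln (real d) * ln (real M) \<le> real (card (S g V)) \<and>
                 real (card (S g V)) \<le> C4 * real d * ln (real d) * ln (real M) \<and>
                 (\<forall>y \<in> unit_sphere d.
                    (\<forall>i \<in> S g V. sgn (inner_prod d (g i) x) = sgn (inner_prod d (g i) y)) \<longrightarrow>
                    norm2 d (\<lambda>k. x k - y k)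
                      \<le> C5 * real d * ln (real d) * ln (real M) /
                         sqrt ((real M)\<^sup>2 + (real d)\<^sup>2 * (ln (real d))\<^sup>2 * (ln (real M))\<^sup>2))}
               \<ge> 1 - 3 * exp (- c * real d * ln (real d)) - exp (- c' * real d * ln (real M)))))"
proof (rule exI[of _ \<Lambda>], rule exI[of _ 1], rule exI[of _ \<Lambda>], rule exI[of _ "\<kappa> * \<Lambda> / 2"],
    rule exI[of _ "2 * \<Lambda> + 2"], rule exI[of _ "2 * \<Lambda>"], rule exI[of _ 1], rule exI[of _ 1],
    intro conjI allI impI ballI)
  show "\<Lambda> > 0" "\<Lambda> > 0" "\<kappa> * \<Lambda> / 2 > 0" "2 * \<Lambda> + 2 > 0" "2 * \<Lambda> > 0"
    using \<Lambda>_bounds by auto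
  show "(1::real) > 0" "(1::real) > 0" "(1::real) > 0" by simp_all
next
  fix d M :: nat
  assume "d \<ge> 1 \<and> M \<ge> 2 \<and> real M / ln (real M) \<ge> \<Lambda> * real d * ln (real d)"
  then show "nat \<lceil>1 * real d * ln (real d)\<rceil> \<le> M"
    using selection_size_le by simp
qed (use random_selection_recovers_prob in
  \<open>simp only: Let_def recovers_def mult_1 mult_minus1 mult_minus_left\<close>)

end
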